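(* Consider the stochastic first-order method described in the context with proximal function $\phi(\mathbf z)=\frac{\hat\rho}{2}\|\mathbf z\|_1^2$ and minibatch gradient estimates $G^k=\frac1{m_k}\sum_{i=1}^{m_k}G(\mathbf x^k,\zeta_i^k)$, and suppose the standing assumptions in the context hold. Suppose $\hat\rho>3/2$, $0<\eta_k\le \frac1L$ for $k=1,\dots,K$, and $p_k=\eta_k/\sum_{j=1}^K\eta_j$. Then there is a constant $c_1(\hat\rho)>0$ depending only on $\hat\rho$ such that $$\mathbb E\big[\mathrm{dist}_{\|\cdot\|_\infty}(0,\partial(f+\delta_X)(\mathbf x^{Y+1}))\big]\le \sqrt{\frac{c_1(\hat\rho)\,\Delta_f}{\sum_{k=1}^K\eta_k}}+\sqrt{\frac{\left(\frac{3c_1(\hat\rho)}{2\hat\rho}+1\right)\sum_{k=1}^K\frac{\eta_k}{m_k}}{\sum_{k=1}^K\eta_k}}\cdot\sqrt{e^2(\log d)\,\sigma_\infty^2}.$$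
   Context: Problem: minimize $f(\mathbf x)=\mathbb E[F(\mathbf x,\zeta)]$ over $\mathbf x\in X$, where $X\subseteq\mathbb R^d$ ($d\ge2$) is nonempty, closed and convex, $\zeta$ is a random vector with values in $\Xi$, $f:\mathbb R^d\to\mathbb R$ is well defined, finite and everywhere differentiable (possibly nonconvex). $\|\cdot\|$ is the Euclidean norm. There is a measurable $G:X\times\Xi\to\mathbb R^d$ (stochastic first-order oracle, which can be evaluated at any $(\mathbf x,\zeta)$) with $\mathbb E[G(\mathbf x,\zeta)]=\nabla f(\mathbf x)$ for all $\mathbf x\in X$. Standing assumptions: (i) $\sigma_\infty^2:=\max_{\mathbf x\in X}\mathbb E[\|G(\mathbf x,\zeta)-\nabla f(\mathbf x)\|_\infty^2]<\infty$; (ii) for a constant $L>0$, $\|\nabla f(\mathbf x)-\nabla f(\mathbf y)\|_\infty\le L\|\mathbf x-\mathbf y\|_1$ for all $\mathbf x,\mathbf y\in X$; (iii) $f(\mathbf x)\ge\underline f$ for all $\mathbf x\in X$, for some $\underline f\in\mathbb R$. Algorithm: choose $\mathbf x^1\in X$ and a positive integer $K$. For $k=1,\dots,K$: form a gradient estimate $G^k$ and set $$\mathbf x^{k+1}=\arg\min_{\mathbf x\in X}\left\{\tfrac12\|\mathbf x-(\mathbf x^k-\eta_kG^k)\|^2+\phi(\mathbf x-\mathbf x^k)\right\}.$$ Output $\mathbf x^{Y+1}$, where $Y$ is a random index, independent of everything else, with $\mathbb P[Y=k]=p_k$, $k=1,\dots,K$. In the minibatch estimate, $m_k$ are positive integers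 and the $\zeta_i^k$ are i.i.d. copies of $\zeta$, drawn afresh at each iteration (independent of the past). Notation: $\Delta_f=\mathbb E[f(\mathbf x^1)]-\underline f$. $\delta_X$ is the indicator function of $X$ ($0$ on $X$, $+\infty$ off $X$), $\partial$ is the Fréchet subdifferential, so for $\mathbf x\in X$, $\partial(f+\delta_X)(\mathbf x)=\nabla f(\mathbf x)+N_X(\mathbf x)$ with $N_X$ the normal cone, and $\mathrm{dist}_{\|\cdot\|_\infty}(0,S)=\inf\{\|\mathbf v\|_\infty:\mathbf v\in S\}$. *)

theory Defs
  imports "HOL-Probability.Probability"
begin

definition l1norm :: "real^'n \<Rightarrow> real" where
  "l1norm x = (\<Sum>i\<in>UNIV. \<bar>x $ i\<bar>)"

definition delta :: "'a set \<Rightarrow> 'a \<Rightarrow> ereal" where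
  "delta X x = (if x \<in> X then 0 else \<infinity>)"

definition frechet_subdiff :: "('a::real_inner \<Rightarrow> ereal) \<Rightarrow> 'a \<Rightarrow> 'a set" where
  "frechet_subdiff h x =
     {v. \<bar>h x\<bar> \<noteq> \<infinity> \<and>
         0 \<le> Liminf (at x) (\<lambda>y. (h y - h x - ereal (v \<bullet> (y - x))) / ereal (norm (y - x)))}"

(* The library's infnorm is the maximum norm on real^'n. The value lies in [0, \<infinity>], so that the
   distance to the empty set is \<infinity>. *)
definition infdist0 :: "'a::euclidean_space set \<Rightarrow> ennreal" where
  "infdist0 S = (INF v\<in>S. ennreal (infnorm v))"

definition minibatch :: "('a \<Rightarrow> 'b \<Rightarrow> 'a::real_vector) \<Rightarrow> nat \<Rightarrow> 'a \<Rightarrow> (nat \<Rightarrow> 'b) \<Rightarrow> 'a" where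
  "minibatch G m x z = (1 / real m) *\<^sub>R (\<Sum>i=1..m. G x (z i))"

(* The library's indep_var requires both variables to have values in the same type. *)
definition indep_rv ::
    "'w measure \<Rightarrow> 'a measure \<Rightarrow> ('w \<Rightarrow> 'a) \<Rightarrow> 'b measure \<Rightarrow> ('w \<Rightarrow> 'b) \<Rightarrow> bool" where
  "indep_rv M S U T V \<longleftrightarrow>
     U \<in> measurable M S \<and> V \<in> measurable M T \<and>
     prob_space.indep_set M
       {U -` A \<inter> space M | A. A \<in> sets S} {V -` B \<inter> space M | B. B \<in> sets T}"

(* The constant in the rate. HOL cannot place a quantifier over the dimension (a type), the sample
   space and the outcome space inside an existential quantifier over the constant, so the constant
   is given in closed form; being a function real \<Rightarrow> real, it depends on \<rho> alone.
   Origin: write D for the l1-length of a step and w for the error of the gradient estimate. The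
   optimality condition of the proximal step gives  dist \<le> (\<rho> + 2) D / \<eta> + |w|  in the maximum
   norm, the descent inequality gives  f(new) \<le> f(old) - (3\<rho>/4 - 1/2) D^2 / \<eta> + (\<eta>/\<rho>) |w|^2,
   and the constant is 2 (\<rho> + 2)^2 / (3\<rho>/4 - 1/2). *)
definition c1 :: "real \<Rightarrow> real" where
  "c1 \<rho> = 8 * (\<rho> + 2)\<^sup>2 / (3 * \<rho> - 2)"

end

theory Submission
  imports Defs
begin

text \<open>
  Write \<open>D\<close> for the l1-length of a step and \<open>w\<close> for the error of the gradient estimate. First-order
  optimality of the proximal step bounds the distance to stationarity by \<open>(\<rho> + 2) D / \<eta> + |w|\<close>. Testing
  optimality with the old iterate bounds the sum of the \<open>D\<^sup>2 / \<eta>\<close> pathwise by the function gap plus a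
  multiple of the sum of the \<open>\<eta> |w|\<^sup>2\<close>. Squaring, averaging over the random index and
  taking square roots yields the rate, once the expectation of \<open>|w|\<^sup>2\<close> is at most
  \<open>e\<^sup>2 ln d \<sigma>\<^sup>2 / m\<close>.

  This variance bound holds because the squared p-norm is \<open>2 (p - 1)\<close>-smooth, so that its expectation
  grows by at most \<open>(p - 1) d powr (2 / p)\<close> times the variance with each centred summand. An even \<open>p\<close>
  between \<open>2 ln d\<close> and \<open>2 ln d + 2\<close> (or \<open>p = 2\<close> for small \<open>d\<close>) suffices. By Fubini on the
  product of the law of the starting point with the sample space, the bound applies
  conditionally on the current iterate.
\<close>

subsection \<open>The l1-norm and the maximum norm\<close>

text \<open>The maximum norm comes from no inner product, so errors of independent summands do not
  add up like variances. A \<open>2q\<close>-norm takes its place: smoothness costs a factor that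
  grows like \<open>q\<close>, comparison with the maximum norm costs \<open>d powr (1 / q)\<close>,
  and \<open>q\<close> near \<open>ln d\<close> keeps the second factor below \<open>e\<close>. This
  is the origin of \<open>ln d\<close> and of one factor \<open>e\<close>; the other absorbs
  rounding.

  The obstacle is that the error of an iteration depends on an iterate that is itself random. No
  conditional expectation is formed. The iterates become a measurable function of the starting point
  and the array of all samples, which requires the minimiser to be unique and continuous in its
  data; integrating over the samples of one iteration with the others frozen then does the work of
  conditioning.

  The distance to the subdifferential is a function without established measurability. It is
  dominated by a measurable function of the random index, the start and the samples, and all
  averaging is carried out on that majorant.\<close>

lemma l1norm_nonneg [simp]: "0 \<le> l1norm x"
  by (simp add: l1norm_def sum_nonneg)

lemma l1norm_0 [simp]: "l1norm 0 = 0"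
  by (simp add: l1norm_def)

lemma l1norm_minus_commute: "l1norm (x - y) = l1norm (y - x)"
  by (simp add: l1norm_def abs_minus_commute)

lemma l1norm_triangle: "l1norm (x + y) \<le> l1norm x + l1norm y"
  by (auto simp: l1norm_def sum.distrib [symmetric] intro!: sum_mono)

lemma l1norm_scaleR: "l1norm (a *\<^sub>R x) = \<bar>a\<bar> * l1norm x"
  by (simp add: l1norm_def abs_mult sum_distrib_left)

lemma l1norm_convex:
  assumes "0 \<le> t" "t \<le> 1"
  shows "l1norm ((1 - t) *\<^sub>R x + t *\<^sub>R y) \<le> (1 - t) * l1norm x + t * l1norm y"
  using l1norm_triangle[of "(1 - t) *\<^sub>R x" "t *\<^sub>R y"] assms by (simp add: l1norm_scaleR)

lemma norm_le_l1norm: "norm x \<le> l1norm x"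
  unfolding l1norm_def by (rule norm_le_l1_cart)

lemma l1norm_axis [simp]: "l1norm (axis i a) = \<bar>a\<bar>"
proof -
  have "(\<Sum>j\<in>UNIV. \<bar>if j = i then a else 0\<bar>) = (\<Sum>j\<in>UNIV. if j = i then \<bar>a\<bar> else 0)"
    by (rule sum.cong) auto
  then show ?thesis
    by (simp add: l1norm_def axis_def)
qed

lemma continuous_on_l1norm [continuous_intros]:
  "continuous_on S g \<Longrightarrow> continuous_on S (\<lambda>x. l1norm (g x))"
  unfolding l1norm_def by (intro continuous_intros)

lemma infnorm_nonneg [simp]: "0 \<le> infnorm x"
  by (rule infnorm_pos_le)

lemma infnorm_le:
  fixes x :: "real^'n"
  assumes "\<And>i. \<bar>x $ i\<bar> \<le> c"
  shows "infnorm x \<le> c"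
  unfolding infnorm_cart using assms by (intro cSup_least) auto

lemma infnorm_le_l1norm:
  fixes x :: "real^'n"
  shows "infnorm x \<le> l1norm x"
  using infnorm_le_norm norm_le_l1norm order_trans by blast

text \<open>Hoelder's inequality for the exponents infinity and 1: gradients are measured in
  \<open>infnorm\<close>, steps in \<open>l1norm\<close>.\<close>

lemma abs_inner_le_infnorm_l1norm:
  fixes x y :: "real^'n"
  shows "\<bar>x \<bullet> y\<bar> \<le> infnorm x * l1norm y"
proof -
  have "\<bar>x \<bullet> y\<bar> \<le> (\<Sum>i\<in>UNIV. \<bar>x $ i * y $ i\<bar>)"
    unfolding inner_vec_def by (simp add: sum_abs)
  also have "\<dots> \<le> (\<Sum>i\<in>UNIV. infnorm x * \<bar>y $ i\<bar>)"
    by (intro sum_mono) (auto simp: abs_mult intro: mult_right_mono component_le_infnorm_cart)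
  finally show ?thesis
    by (simp add: l1norm_def sum_distrib_left)
qed

subsection \<open>The proximal step\<close>

text \<open>The point \<open>y\<close> is kept apart from \<open>x\<close>, although the method uses
  only \<open>y = x - \<eta> *\<^sub>R g\<close>: continuity in the pair is what measurability of
  the iterates rests on.\<close>

definition prox_obj :: "real \<Rightarrow> real^'n \<Rightarrow> real^'n \<Rightarrow> real^'n \<Rightarrow> real" where
  "prox_obj \<rho> x y u = 1 / 2 * (norm (u - y))\<^sup>2 + \<rho> / 2 * (l1norm (u - x))\<^sup>2"

text \<open>Divide by \<open>t\<close> and let it tend to 0 from the right.\<close>

lemma limit_coeff_nonneg:
  fixes a b :: real
  assumes "\<And>t. 0 < t \<Longrightarrow> t < 1 \<Longrightarrow> 0 \<le> t * a + t\<^sup>2 * b"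
  shows "0 \<le> a"
proof (rule tendsto_lowerbound)
  show "((\<lambda>t. a + t * b) \<longlongrightarrow> a) (at_right 0)"
    by (auto intro!: tendsto_eq_intros)
  have "0 \<le> a + t * b" if "0 < t" "t < 1" for t
  proof -
    have "0 \<le> t * (a + t * b)"
      using assms[OF that] by (simp add: algebra_simps power2_eq_square)
    then show ?thesis using that by (simp add: zero_le_mult_iff)
  qed
  then show "\<forall>\<^sub>F t in at_right 0. 0 \<le> a + t * b"
    by (intro eventually_at_rightI[of 0 1]) auto
qed simp

text \<open>Compare \<open>v\<close> with \<open>(1 - t) v + t u\<close>. The l1-norm need not be
  differentiable, but by convexity it grows along the segment at most affinely in \<open>t\<close>,
  so the objective changes by at most \<open>t * a + t\<^sup>2 * b\<close>, and
  \<open>limit_coeff_nonneg\<close> isolates \<open>a\<close>.\<close>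

lemma prox_first_order:
  assumes X: "convex X" and \<rho>: "0 \<le> \<rho>"
    and min: "is_arg_min (prox_obj \<rho> x y) (\<lambda>u. u \<in> X) v" and u: "u \<in> X"
  shows "0 \<le> (v - y) \<bullet> (u - v) + \<rho> * l1norm (v - x) * (l1norm (u - x) - l1norm (v - x))"
    (is "0 \<le> ?a")
proof (rule limit_coeff_nonneg)
  fix t :: real
  assume t: "0 < t" "t < 1"
  define D E where "D = l1norm (v - x)" and "E = l1norm (u - x)"
  have v: "v \<in> X" and le: "\<And>w. w \<in> X \<Longrightarrow> prox_obj \<rho> x y v \<le> prox_obj \<rho> x y w"
    using min by (auto simp: is_arg_min_def not_less)
  define w where "w = (1 - t) *\<^sub>R v + t *\<^sub>R u"
  have "w \<in> X" unfolding w_def using X u v t by (intro convexD_alt) auto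
  then have *: "prox_obj \<rho> x y v \<le> prox_obj \<rho> x y w" by (rule le)
  have "w - y = (v - y) + t *\<^sub>R (u - v)" by (simp add: w_def algebra_simps)
  then have n: "(norm (w - y))\<^sup>2 = (norm (v - y))\<^sup>2 + 2 * t * ((v - y) \<bullet> (u - v)) + t\<^sup>2 * (norm (u - v))\<^sup>2"
    by (simp only: power2_norm_eq_inner)
      (simp add: inner_add_left inner_add_right inner_commute algebra_simps power2_eq_square)
  have "w - x = (1 - t) *\<^sub>R (v - x) + t *\<^sub>R (u - x)" by (simp add: w_def algebra_simps)
  then have "l1norm (w - x) \<le> (1 - t) * D + t * E"
    using l1norm_convex[of t "v - x" "u - x"] t by (simp only: D_def E_def)
  then have "l1norm (w - x) \<le> D + t * (E - D)"
    by (simp add: algebra_simps)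
  then have "(l1norm (w - x))\<^sup>2 \<le> (D + t * (E - D))\<^sup>2"
    by (intro power_mono) auto
  then have "\<rho> / 2 * (l1norm (w - x))\<^sup>2 \<le> \<rho> / 2 * (D\<^sup>2 + 2 * t * D * (E - D) + t\<^sup>2 * (E - D)\<^sup>2)"
    using \<rho> by (intro mult_left_mono) (auto simp: algebra_simps power2_eq_square)
  with * n show "0 \<le> t * ?a + t\<^sup>2 * ((norm (u - v))\<^sup>2 / 2 + \<rho> / 2 * (E - D)\<^sup>2)"
    unfolding prox_obj_def D_def[symmetric] E_def[symmetric]
    by (simp add: algebra_simps)
qed

text \<open>The Euclidean term supplies all the strong convexity. The proximal term only contributes
  \<open>\<rho> * D * (E - D) \<le> \<rho> / 2 * (E\<^sup>2 - D\<^sup>2)\<close>, that is,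
  nonnegativity of \<open>(E - D)\<^sup>2\<close>.\<close>

lemma prox_strong:
  assumes X: "convex X" and \<rho>: "0 \<le> \<rho>"
    and min: "is_arg_min (prox_obj \<rho> x y) (\<lambda>u. u \<in> X) v" and u: "u \<in> X"
  shows "prox_obj \<rho> x y v + 1 / 2 * (norm (u - v))\<^sup>2 \<le> prox_obj \<rho> x y u"
proof -
  define D E where "D = l1norm (v - x)" and "E = l1norm (u - x)"
  have "u - y = (v - y) + (u - v)" by simp
  then have n: "(norm (u - y))\<^sup>2 = (norm (v - y))\<^sup>2 + 2 * ((v - y) \<bullet> (u - v)) + (norm (u - v))\<^sup>2"
    by (simp only: power2_norm_eq_inner)
      (simp add: inner_add_left inner_add_right inner_commute algebra_simps)
  have "0 \<le> \<rho> / 2 * (E - D)\<^sup>2" using \<rho> by simp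
  then have "\<rho> * D * (E - D) \<le> \<rho> / 2 * E\<^sup>2 - \<rho> / 2 * D\<^sup>2"
    by (simp add: algebra_simps power2_eq_square)
  with prox_first_order[OF assms] n show ?thesis
    unfolding prox_obj_def D_def[symmetric] E_def[symmetric] by linarith
qed

lemma prox_unique:
  assumes "convex X" "0 \<le> \<rho>"
    and "is_arg_min (prox_obj \<rho> x y) (\<lambda>u. u \<in> X) v"
    and "is_arg_min (prox_obj \<rho> x y) (\<lambda>u. u \<in> X) w"
  shows "v = w"
proof -
  have "w \<in> X" "\<not> prox_obj \<rho> x y v < prox_obj \<rho> x y w"
    using assms by (auto simp: is_arg_min_def)
  with prox_strong[OF assms(1-3) \<open>w \<in> X\<close>] have "(norm (w - v))\<^sup>2 \<le> 0" by linarith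
  then show ?thesis by simp
qed

text \<open>The Euclidean term alone confines the sublevel set of a feasible point to a ball around
  \<open>y\<close>; compactness does the rest.\<close>

lemma prox_exists:
  assumes "X \<noteq> {}" "closed X" "0 \<le> \<rho>"
  shows "\<exists>v. is_arg_min (prox_obj \<rho> x y) (\<lambda>u. u \<in> X) v"
proof -
  obtain u0 where u0: "u0 \<in> X" using assms by auto
  define r where "r = sqrt (2 * prox_obj \<rho> x y u0)"
  have nn: "0 \<le> prox_obj \<rho> x y u" for u using assms by (simp add: prox_obj_def)
  have in_ball: "u \<in> cball y r" if "prox_obj \<rho> x y u \<le> prox_obj \<rho> x y u0" for u
  proof -
    have "0 \<le> \<rho> / 2 * (l1norm (u - x))\<^sup>2" using assms by simp
    with that have "(norm (u - y))\<^sup>2 \<le> 2 * prox_obj \<rho> x y u0"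
      unfolding prox_obj_def[of _ _ _ u] by simp
    then have "norm (u - y) \<le> r" unfolding r_def by (rule real_le_rsqrt)
    then show ?thesis by (simp add: dist_norm norm_minus_commute)
  qed
  have "compact (X \<inter> cball y r)" using assms by (intro closed_Int_compact) auto
  moreover have "X \<inter> cball y r \<noteq> {}" using u0 in_ball[of u0] by auto
  moreover have "continuous_on (X \<inter> cball y r) (prox_obj \<rho> x y)"
    unfolding prox_obj_def by (intro continuous_intros)
  ultimately obtain v where v: "v \<in> X \<inter> cball y r"
    and le: "\<And>u. u \<in> X \<inter> cball y r \<Longrightarrow> prox_obj \<rho> x y v \<le> prox_obj \<rho> x y u"
    using continuous_attains_inf by metis
  have "prox_obj \<rho> x y v \<le> prox_obj \<rho> x y u" if "u \<in> X" for u
  proof (cases "u \<in> cball y r")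
    case True with that le show ?thesis by auto
  next
    case False
    then have "prox_obj \<rho> x y u0 < prox_obj \<rho> x y u" using in_ball[of u] by force
    moreover have "prox_obj \<rho> x y v \<le> prox_obj \<rho> x y u0"
      using u0 in_ball[of u0] by (intro le) auto
    ultimately show ?thesis by simp
  qed
  with v show ?thesis by (auto simp: is_arg_min_def not_less)
qed

text \<open>The method fixes its iterates by a minimisation property only; expressing them through
  the samples takes a function. By \<open>prox_unique\<close> the choice is determined.\<close>

definition prox :: "(real^'n) set \<Rightarrow> real \<Rightarrow> real^'n \<Rightarrow> real^'n \<Rightarrow> real^'n" where
  "prox X \<rho> x y = (SOME v. is_arg_min (prox_obj \<rho> x y) (\<lambda>u. u \<in> X) v)"

lemma prox_is_arg_min:
  assumes "X \<noteq> {}" "closed X" "0 \<le> \<rho>"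
  shows "is_arg_min (prox_obj \<rho> x y) (\<lambda>u. u \<in> X) (prox X \<rho> x y)"
  unfolding prox_def using prox_exists[OF assms] by (rule someI_ex)

lemma prox_eqI:
  assumes "X \<noteq> {}" "closed X" "convex X" "0 \<le> \<rho>"
    and "is_arg_min (prox_obj \<rho> x y) (\<lambda>u. u \<in> X) v"
  shows "prox X \<rho> x y = v"
  using prox_unique prox_is_arg_min assms by blast

text \<open>Each of the two minimisers is inserted into the strong convexity inequality of the other; only
  joint continuity of \<open>prox\<close> is needed, because it makes the iterates measurable.\<close>

lemma prox_perturbation:
  fixes x y x' y' :: "real^'n"
  assumes X: "X \<noteq> {}" "closed X" "convex X" and \<rho>: "0 \<le> \<rho>"
  defines "v \<equiv> prox X \<rho> x y" and "v' \<equiv> prox X \<rho> x' y'"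
  shows "(norm (v' - v))\<^sup>2 \<le> norm (v' - v) * (norm (y' - y) + \<rho> * (1 + real CARD('n)) * l1norm (x - x'))
    + \<rho> * l1norm (x - x') * (2 * l1norm (v - x) + l1norm (x - x'))"
proof -
  define r s where "r = norm (v' - v)" and "s = l1norm (x - x')"
  have am: "is_arg_min (prox_obj \<rho> x y) (\<lambda>u. u \<in> X) v" "is_arg_min (prox_obj \<rho> x' y') (\<lambda>u. u \<in> X) v'"
    unfolding v_def v'_def using X \<rho> by (auto intro: prox_is_arg_min)
  then have mem: "v \<in> X" "v' \<in> X" by (auto simp: is_arg_min_def)
  have 1: "r\<^sup>2 \<le> (prox_obj \<rho> x y v' - prox_obj \<rho> x' y' v') + (prox_obj \<rho> x' y' v - prox_obj \<rho> x y v)"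
    using prox_strong[OF X(3) \<rho> am(1) mem(2)] prox_strong[OF X(3) \<rho> am(2) mem(1)]
    by (simp add: r_def norm_minus_commute)
  have l1r: "l1norm (v' - v) \<le> real CARD('n) * r"
    unfolding l1norm_def r_def
    by (rule sum_bounded_above) (rule component_le_norm_cart)
  \<comment> \<open>The four squares collapse to one inner product, so this part is of first order
    in \<open>y' - y\<close>.\<close>
  have 2: "1 / 2 * (norm (v' - y))\<^sup>2 - 1 / 2 * (norm (v' - y'))\<^sup>2 + 1 / 2 * (norm (v - y'))\<^sup>2 - 1 / 2 * (norm (v - y))\<^sup>2
      = (v' - v) \<bullet> (y' - y)"
    by (simp only: power2_norm_eq_inner) (simp add: inner_diff_left inner_diff_right inner_commute field_simps)
  have 3: "(v' - v) \<bullet> (y' - y) \<le> r * norm (y' - y)"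
    unfolding r_def by (rule norm_cauchy_schwarz)
  have shift: "l1norm (u - x) \<le> l1norm (u - x') + s" "l1norm (u - x') \<le> l1norm (u - x) + s" for u
    using l1norm_triangle[of "u - x'" "x' - x"] l1norm_triangle[of "u - x" "x - x'"]
    by (simp_all add: s_def l1norm_minus_commute[of x' x])
  have sq: "(l1norm (u - x))\<^sup>2 - (l1norm (u - x'))\<^sup>2 \<le> s * (2 * l1norm (u - x) + s)"
    "(l1norm (u - x'))\<^sup>2 - (l1norm (u - x))\<^sup>2 \<le> s * (2 * l1norm (u - x) + s)" for u
  proof -
    have "\<bar>(l1norm (u - x))\<^sup>2 - (l1norm (u - x'))\<^sup>2\<bar>
        = \<bar>l1norm (u - x) - l1norm (u - x')\<bar> * \<bar>l1norm (u - x) + l1norm (u - x')\<bar>"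
      by (simp only: power2_eq_square square_diff_square_factored abs_mult mult.commute)
    also have "\<dots> \<le> s * (2 * l1norm (u - x) + s)"
      using shift[of u] by (intro mult_mono) (auto simp: s_def)
    finally show "(l1norm (u - x))\<^sup>2 - (l1norm (u - x'))\<^sup>2 \<le> s * (2 * l1norm (u - x) + s)"
      "(l1norm (u - x'))\<^sup>2 - (l1norm (u - x))\<^sup>2 \<le> s * (2 * l1norm (u - x) + s)"
      by (simp_all add: abs_le_iff)
  qed
  have v'x: "l1norm (v' - x) \<le> l1norm (v - x) + real CARD('n) * r"
    using l1norm_triangle[of "v' - v" "v - x"] l1r by simp
  have s0: "0 \<le> s" by (simp add: s_def)
  \<comment> \<open>Everything is expressed through \<open>l1norm (v - x)\<close>, which stays fixed
    while the primed data vary; replacing \<open>v'\<close> costs a multiple of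
    \<open>r * s\<close>.\<close>
  have "(l1norm (v' - x))\<^sup>2 - (l1norm (v' - x'))\<^sup>2 + (l1norm (v - x'))\<^sup>2 - (l1norm (v - x))\<^sup>2
      \<le> s * (2 * l1norm (v' - x) + s) + s * (2 * l1norm (v - x) + s)"
    using sq(1)[of v'] sq(2)[of v] by simp
  also have "\<dots> \<le> s * (2 * (l1norm (v - x) + real CARD('n) * r) + s) + s * (2 * l1norm (v - x) + s)"
    using v'x s0 by (intro add_mono mult_left_mono) auto
  also have "\<dots> = 2 * (real CARD('n) * r * s + s * (2 * l1norm (v - x) + s))"
    by (simp add: algebra_simps)
  finally have "\<rho> / 2 * ((l1norm (v' - x))\<^sup>2 - (l1norm (v' - x'))\<^sup>2 + (l1norm (v - x'))\<^sup>2 - (l1norm (v - x))\<^sup>2)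
      \<le> \<rho> / 2 * (2 * (real CARD('n) * r * s + s * (2 * l1norm (v - x) + s)))"
    using \<rho> by (intro mult_left_mono) auto
  moreover have "0 \<le> \<rho> * r * s" using \<rho> s0 by (simp add: r_def)
  ultimately show ?thesis
    using 1 2 3 unfolding prox_obj_def r_def[symmetric] s_def[symmetric]
    by (simp add: algebra_simps)
qed

text \<open>Solving the quadratic inequality for \<open>r z\<close> gives
  \<open>r z \<le> b z + sqrt |c z|\<close>.\<close>

lemma tendsto_zero_of_quadratic_bound:
  fixes r :: "'a \<Rightarrow> real"
  assumes "\<And>z. 0 \<le> r z" "\<And>z. 0 \<le> b z" "\<And>z. (r z)\<^sup>2 \<le> r z * b z + c z"
    and "(b \<longlongrightarrow> 0) A" "(c \<longlongrightarrow> 0) A"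
  shows "(r \<longlongrightarrow> 0) A"
proof (rule tendsto_sandwich[of "\<lambda>_. 0" _ _ "\<lambda>z. b z + sqrt \<bar>c z\<bar>"])
  have "r z \<le> b z + sqrt \<bar>c z\<bar>" for z
  proof (rule ccontr)
    assume "\<not> ?thesis"
    then have h: "sqrt \<bar>c z\<bar> < r z - b z" by simp
    then have "\<bar>c z\<bar> < (r z - b z)\<^sup>2"
      by (smt (verit) real_sqrt_abs real_sqrt_less_iff real_sqrt_ge_zero)
    also have "\<dots> \<le> (r z - b z) * r z"
      unfolding power2_eq_square using h assms(2)[of z]
      by (intro mult_left_mono) (use h real_sqrt_ge_zero[of "\<bar>c z\<bar>"] in linarith)+
    finally show False using assms(3)[of z] by (simp add: algebra_simps power2_eq_square)
  qed
  then show "\<forall>\<^sub>F z in A. r z \<le> b z + sqrt \<bar>c z\<bar>" by simp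
  show "((\<lambda>z. b z + sqrt \<bar>c z\<bar>) \<longlongrightarrow> 0) A"
    using assms(4,5) by (auto intro!: tendsto_eq_intros)
qed (use assms in auto)

lemma continuous_prox:
  fixes X :: "(real^'n) set"
  assumes X: "X \<noteq> {}" "closed X" "convex X" and \<rho>: "0 \<le> \<rho>"
  shows "continuous_on UNIV (\<lambda>(x, y). prox X \<rho> x y)"
  unfolding continuous_on_eq_continuous_at[OF open_UNIV] isCont_def
proof (intro ballI, clarify)
  fix x y :: "real^'n"
  let ?P = "\<lambda>z. prox X \<rho> (fst z) (snd z)"
  let ?A = "at (x, y)"
  have f: "(fst \<longlongrightarrow> x) ?A" "(snd \<longlongrightarrow> y) ?A"
    by (auto intro!: tendsto_eq_intros)
  have s: "((\<lambda>z. l1norm (x - fst z)) \<longlongrightarrow> 0) ?A"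
    unfolding l1norm_def using f(1)
    by (auto intro!: tendsto_eq_intros)
  have "((\<lambda>z. norm (?P z - prox X \<rho> x y)) \<longlongrightarrow> 0) ?A"
  proof (rule tendsto_zero_of_quadratic_bound)
    fix z
    show "(norm (?P z - prox X \<rho> x y))\<^sup>2 \<le> norm (?P z - prox X \<rho> x y) *
       (norm (snd z - y) + \<rho> * (1 + real CARD('n)) * l1norm (x - fst z))
       + \<rho> * l1norm (x - fst z) * (2 * l1norm (prox X \<rho> x y - x) + l1norm (x - fst z))"
      by (rule prox_perturbation[OF assms])
    show "((\<lambda>z. norm (snd z - y) + \<rho> * (1 + real CARD('n)) * l1norm (x - fst z)) \<longlongrightarrow> 0) ?A"
      using f s by (auto intro!: tendsto_eq_intros)
    show "((\<lambda>z. \<rho> * l1norm (x - fst z) * (2 * l1norm (prox X \<rho> x y - x) + l1norm (x - fst z))) \<longlongrightarrow> 0) ?A"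
      using s by (auto intro!: tendsto_eq_intros)
  qed (use \<rho> in auto)
  then show "((\<lambda>(x, y). prox X \<rho> x y) \<longlongrightarrow> prox X \<rho> x y) ?A"
    by (simp add: tendsto_norm_zero_iff LIM_zero_iff split_def)
qed

text \<open>The subgradient of the proximal term at the minimiser comes from separating the strict
  epigraph \<open>A\<close> of the linearised proximal term from the set \<open>B\<close> below the linear part over \<open>X\<close>.\<close>

lemma prox_normal_vector:
  assumes X: "convex X" and \<rho>: "0 \<le> \<rho>"
    and min: "is_arg_min (prox_obj \<rho> x y) (\<lambda>u. u \<in> X) v"
  obtains c :: "real^'n" where "infnorm c \<le> \<rho> * l1norm (v - x)"
    "\<And>u. u \<in> X \<Longrightarrow> 0 \<le> (v - y - c) \<bullet> (u - v)"
proof -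
  define D a where "D = l1norm (v - x)" and "a = v - y"
  \<comment> \<open>By the chain rule, the subgradients of the proximal term at \<open>v\<close> are
    \<open>\<rho> * D\<close> times those of the l1-norm. The variable \<open>w\<close> is a
    displacement from \<open>v\<close>.\<close>
  define \<psi> where "\<psi> w = \<rho> * D * l1norm (w + (v - x))" for w
  define A where "A = {(w, t). \<psi> w < t}"
  define B where "B = {(w, t). w + v \<in> X \<and> t \<le> \<rho> * D * D - a \<bullet> w}"
  have v: "v \<in> X" using min by (simp add: is_arg_min_def)
  have D0: "0 \<le> \<rho> * D" using \<rho> by (simp add: D_def)
  have \<psi>_convex: "\<psi> ((1 - s) *\<^sub>R w + s *\<^sub>R w') \<le> (1 - s) * \<psi> w + s * \<psi> w'" if "0 \<le> s" "s \<le> 1" for s w w'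
  proof -
    have "(1 - s) *\<^sub>R w + s *\<^sub>R w' + (v - x) = (1 - s) *\<^sub>R (w + (v - x)) + s *\<^sub>R (w' + (v - x))"
      by (simp add: algebra_simps)
    then have "\<psi> ((1 - s) *\<^sub>R w + s *\<^sub>R w')
        \<le> \<rho> * D * ((1 - s) * l1norm (w + (v - x)) + s * l1norm (w' + (v - x)))"
      unfolding \<psi>_def using l1norm_convex[OF that] D0 by (auto intro: mult_left_mono)
    then show ?thesis by (simp add: \<psi>_def algebra_simps)
  qed
  have "convex A"
    unfolding convex_alt
  proof (clarsimp simp: A_def)
    fix w t w' t' and s :: real
    assume "\<psi> w < t" "\<psi> w' < t'" "0 \<le> s" "s \<le> 1"
    moreover from this have "(1 - s) * \<psi> w + s * \<psi> w' < (1 - s) * t + s * t'"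
      by (cases "s = 0") (auto intro!: add_le_less_mono mult_left_mono)
    ultimately show "\<psi> ((1 - s) *\<^sub>R w + s *\<^sub>R w') < (1 - s) * t + s * t'"
      using \<psi>_convex[of s w w'] by simp
  qed
  moreover have "convex B"
    unfolding convex_alt
  proof (clarsimp simp: B_def)
    fix w t w' t' and s :: real
    assume h: "w + v \<in> X" "t \<le> \<rho> * D * D - a \<bullet> w" "w' + v \<in> X" "t' \<le> \<rho> * D * D - a \<bullet> w'" "0 \<le> s" "s \<le> 1"
    have "(1 - s) *\<^sub>R (w + v) + s *\<^sub>R (w' + v) \<in> X"
      using X h by (intro convexD_alt)
    moreover have "(1 - s) *\<^sub>R (w + v) + s *\<^sub>R (w' + v) = (1 - s) *\<^sub>R w + s *\<^sub>R w' + v"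
      by (simp add: algebra_simps)
    moreover have "(1 - s) * t + s * t' \<le> (1 - s) * (\<rho> * D * D - a \<bullet> w) + s * (\<rho> * D * D - a \<bullet> w')"
      using h by (intro add_mono mult_left_mono) auto
    ultimately show "(1 - s) *\<^sub>R w + s *\<^sub>R w' + v \<in> X \<and>
       (1 - s) * t + s * t' \<le> \<rho> * D * D - a \<bullet> ((1 - s) *\<^sub>R w + s *\<^sub>R w')"
      by (simp add: inner_add_right algebra_simps)
  qed
  moreover have "(0, \<psi> 0 + 1) \<in> A" by (simp add: A_def)
  moreover have B0: "(0, \<rho> * D * D) \<in> B" using v by (simp add: B_def)
  \<comment> \<open>A common point would violate \<open>prox_first_order\<close> at
    \<open>w + v\<close>.\<close>
  moreover have "A \<inter> B = {}"
  proof (rule ccontr)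
    assume "A \<inter> B \<noteq> {}"
    then obtain w t where h: "\<psi> w < t" "w + v \<in> X" "t \<le> \<rho> * D * D - a \<bullet> w" by (auto simp: A_def B_def)
    with prox_first_order[OF assms h(2)] show False
      by (simp add: \<psi>_def D_def a_def algebra_simps)
  qed
  ultimately obtain p b where pb: "p \<noteq> 0" "\<And>z. z \<in> B \<Longrightarrow> p \<bullet> z \<le> b" "\<And>z. z \<in> A \<Longrightarrow> b \<le> p \<bullet> z"
    using separating_hyperplane_sets[of B A] by blast
  obtain c0 \<tau> where p: "p = (c0, \<tau>)" by force
  have A_ge: "b \<le> c0 \<bullet> w + \<tau> * t" if "\<psi> w < t" for w t
    using pb(3)[of "(w, t)"] that by (simp add: A_def p)
  have B_le: "c0 \<bullet> w + \<tau> * t \<le> b" if "w + v \<in> X" "t \<le> \<rho> * D * D - a \<bullet> w" for w t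
    using pb(2)[of "(w, t)"] that by (simp add: B_def p)
  \<comment> \<open>A vertical hyperplane is impossible: \<open>A\<close> projects onto the whole
    space, where no nonzero linear form is bounded below.\<close>
  have "\<tau> \<noteq> 0"
  proof
    assume "\<tau> = 0"
    then have ge: "b \<le> c0 \<bullet> w" for w using A_ge[of w "\<psi> w + 1"] by simp
    have "0 \<le> b" using B_le[of 0 "\<rho> * D * D"] v \<open>\<tau> = 0\<close> by simp
    with ge[of "- c0"] have "c0 \<bullet> c0 \<le> 0" by simp
    then have "c0 = 0" by (metis inner_gt_zero_iff not_less)
    then show False using pb(1) p \<open>\<tau> = 0\<close> by (simp add: zero_prod_def)
  qed
  moreover have "0 \<le> \<tau>"
  proof -
    have "\<tau> * (\<rho> * D * D) \<le> \<tau> * (\<rho> * D * D + 1)"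
      using B_le[of 0 "\<rho> * D * D"] A_ge[of 0 "\<rho> * D * D + 1"] v by (simp add: \<psi>_def D_def)
    then show ?thesis by (simp add: algebra_simps)
  qed
  ultimately have \<tau>: "0 < \<tau>" by simp
  have b: "b \<le> c0 \<bullet> w + \<tau> * \<psi> w" for w
  proof (rule field_le_epsilon)
    fix e :: real assume "0 < e"
    then show "b \<le> c0 \<bullet> w + \<tau> * \<psi> w + e"
      using A_ge[of w "\<psi> w + e / \<tau>"] \<tau> by (simp add: algebra_simps)
  qed
  \<comment> \<open>The graph of \<open>\<psi>\<close> touches \<open>B\<close> at displacement 0,
    which fixes the offset.\<close>
  have b_eq: "b = \<tau> * (\<rho> * D * D)"
    using b[of 0] B_le[of 0 "\<rho> * D * D"] v by (simp add: \<psi>_def D_def)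
  \<comment> \<open>After this normalisation \<open>- c\<close> is a subgradient of
    \<open>\<psi>\<close> at 0.\<close>
  define c where "c = (1 / \<tau>) *\<^sub>R c0"
  have c0: "c0 = \<tau> *\<^sub>R c" using \<tau> by (simp add: c_def)
  show thesis
  proof
    fix u assume "u \<in> X"
    then have "\<tau> * (c \<bullet> (u - v) + (\<rho> * D * D - a \<bullet> (u - v))) \<le> \<tau> * (\<rho> * D * D)"
      using B_le[of "u - v" "\<rho> * D * D - a \<bullet> (u - v)"] by (simp add: b_eq c0 algebra_simps)
    then show "0 \<le> (v - y - c) \<bullet> (u - v)"
      using \<tau> by (simp add: a_def inner_diff_left)
  next
    have "\<rho> * D * D \<le> c \<bullet> w + \<psi> w" for w
    proof -
      have "\<tau> * (\<rho> * D * D) \<le> \<tau> * (c \<bullet> w + \<psi> w)"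
        using b[of w] by (simp add: b_eq c0 algebra_simps)
      then show ?thesis using \<tau> by simp
    qed
    moreover have "\<psi> w \<le> \<rho> * D * l1norm w + \<rho> * D * D" for w
      unfolding \<psi>_def using mult_left_mono[OF l1norm_triangle[of w "v - x"] D0]
      by (simp add: D_def algebra_simps)
    ultimately have "- (c \<bullet> w) \<le> \<rho> * D * l1norm w" for w
      by (smt (verit))
    \<comment> \<open>Signed unit vectors have l1-norm 1 and pick out the coordinates of
      \<open>c\<close>.\<close>
    from this[of "axis i 1" for i] this[of "axis i (-1)" for i]
    have "\<bar>c $ i\<bar> \<le> \<rho> * D" for i
      by (simp add: inner_axis abs_le_iff)
    then show "infnorm c \<le> \<rho> * l1norm (v - x)"
      unfolding D_def by (rule infnorm_le)
  qed
qed

subsection \<open>Stationarity and descent\<close>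

lemma GDERIV_imp_DERIV_line:
  fixes f :: "'a::real_inner \<Rightarrow> real"
  assumes "GDERIV f (x + t *\<^sub>R d) :> g"
  shows "((\<lambda>t. f (x + t *\<^sub>R d)) has_real_derivative (g \<bullet> d)) (at t)"
proof -
  have "((\<lambda>t. x + t *\<^sub>R d) has_derivative (\<lambda>h. h *\<^sub>R d)) (at t)"
    by (auto intro!: derivative_eq_intros)
  moreover have "(f has_derivative (\<lambda>h. h \<bullet> g)) (at (x + t *\<^sub>R d))"
    using assms by (simp add: gderiv_def)
  ultimately have "((\<lambda>t. f (x + t *\<^sub>R d)) has_derivative (\<lambda>h. (h *\<^sub>R d) \<bullet> g)) (at t)"
    by (rule has_derivative_compose)
  moreover have "(\<lambda>h. (h *\<^sub>R d) \<bullet> g) = (*) (g \<bullet> d)"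
    by (auto simp: fun_eq_iff inner_commute)
  ultimately show ?thesis by (simp only: has_field_derivative_def)
qed

text \<open>Instead of integrating the gradient, subtract the claimed majorant along the segment: by
  Hoelder and the Lipschitz bound the difference \<open>h\<close> has nonpositive derivative.
  Convexity keeps the segment inside \<open>X\<close>, where the Lipschitz bound is
  available.\<close>

lemma descent_inequality:
  fixes X :: "(real^'n) set"
  assumes X: "convex X" and grad: "\<And>u. GDERIV f u :> gradf u"
    and lip: "\<And>u v. u \<in> X \<Longrightarrow> v \<in> X \<Longrightarrow> infnorm (gradf u - gradf v) \<le> L * l1norm (u - v)"
    and xy: "x \<in> X" "y \<in> X"
  shows "f y \<le> f x + gradf x \<bullet> (y - x) + L / 2 * (l1norm (y - x))\<^sup>2"
proof -
  define d where "d = y - x"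
  define h where "h t = f (x + t *\<^sub>R d) - t * (gradf x \<bullet> d) - L / 2 * t\<^sup>2 * (l1norm d)\<^sup>2" for t
  have "h 1 \<le> h 0"
  proof (rule DERIV_nonpos_imp_nonincreasing[of 0 1 h])
    fix t :: real assume t: "0 \<le> t" "t \<le> 1"
    let ?z = "x + t *\<^sub>R d"
    have "?z = (1 - t) *\<^sub>R x + t *\<^sub>R y" by (simp add: d_def algebra_simps)
    then have z: "?z \<in> X" using convexD_alt[OF X xy t] by simp
    have "(gradf ?z - gradf x) \<bullet> d \<le> infnorm (gradf ?z - gradf x) * l1norm d"
      using abs_inner_le_infnorm_l1norm abs_le_iff by blast
    also have "\<dots> \<le> L * l1norm (?z - x) * l1norm d"
      using lip[OF z xy(1)] by (intro mult_right_mono) auto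
    also have "\<dots> = L * t * (l1norm d)\<^sup>2"
      using t by (simp add: l1norm_scaleR power2_eq_square)
    finally have "gradf ?z \<bullet> d - gradf x \<bullet> d - L * t * (l1norm d)\<^sup>2 \<le> 0"
      by (simp add: inner_diff_left)
    moreover have "(h has_real_derivative (gradf ?z \<bullet> d - gradf x \<bullet> d - L * t * (l1norm d)\<^sup>2)) (at t)"
      unfolding h_def
      by (auto intro!: derivative_eq_intros GDERIV_imp_DERIV_line[OF grad])
    ultimately show "\<exists>y. (h has_real_derivative y) (at t) \<and> y \<le> 0" by blast
  qed simp
  then show ?thesis by (simp add: h_def d_def)
qed

text \<open>Off \<open>X\<close> the quotient is infinite; on \<open>X\<close> the normal vector
  only raises a quotient that tends to 0 by differentiability. Exhibiting one member suffices for an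
  upper bound on the distance.\<close>

lemma frechet_subdiff_memI:
  fixes f :: "real^'n \<Rightarrow> real"
  assumes x: "x \<in> X" and grad: "GDERIV f x :> g"
    and normal: "\<And>u. u \<in> X \<Longrightarrow> n \<bullet> (u - x) \<le> 0"
  shows "g + n \<in> frechet_subdiff (\<lambda>u. ereal (f u) + delta X u) x"
proof -
  let ?h = "\<lambda>u. ereal (f u) + delta X u"
  let ?q = "\<lambda>y. (?h y - ?h x - ereal ((g + n) \<bullet> (y - x))) / ereal (norm (y - x))"
  have ev: "\<forall>\<^sub>F y in at x. - e \<le> (f y - f x - g \<bullet> (y - x)) / norm (y - x)" if "0 < e" for e
  proof -
    have "((\<lambda>y. (f y - f x - (y - x) \<bullet> g) /\<^sub>R norm (y - x)) \<longlongrightarrow> 0) (at x)"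
      using grad unfolding gderiv_def has_derivative_at_within by blast
    then have "\<forall>\<^sub>F y in at x. - e < (f y - f x - (y - x) \<bullet> g) /\<^sub>R norm (y - x)"
      using that by (intro order_tendstoD) auto
    then show ?thesis
      by eventually_elim (simp add: inner_commute divide_inverse mult.commute)
  qed
  have "ereal (- e) \<le> Liminf (at x) ?q" if e: "0 < e" for e
  proof (rule Liminf_bounded)
    show "\<forall>\<^sub>F y in at x. ereal (- e) \<le> ?q y"
      using ev[OF e] eventually_neq_at_within[of x x UNIV]
    proof eventually_elim
      case (elim y)
      show ?case
      proof (cases "y \<in> X")
        case True
        have "(f y - f x - g \<bullet> (y - x)) / norm (y - x) \<le> (f y - f x - (g + n) \<bullet> (y - x)) / norm (y - x)"
          using normal[OF True] by (intro divide_right_mono) (auto simp: inner_add_left)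
        with elim show ?thesis using True x by (simp add: delta_def)
      next
        case False
        with elim x show ?thesis by (simp add: delta_def)
      qed
    qed
  qed
  then have Liminf_ge: "ereal (- e) \<le> Liminf (at x) ?q" if "0 < e" for e
    using that by blast
  have "0 \<le> Liminf (at x) ?q"
  proof (rule ccontr)
    assume "\<not> 0 \<le> Liminf (at x) ?q"
    then have "Liminf (at x) ?q < 0" by (simp only: not_le)
    then obtain r where "Liminf (at x) ?q < ereal r" "ereal r < 0"
      using ereal_dense2 by blast
    with Liminf_ge[of "- r"] show False by simp
  qed
  then show ?thesis using x by (simp add: frechet_subdiff_def delta_def)
qed

text \<open>The element \<open>gradf v + n\<close> splits into four parts: the change of the
  gradient, at most \<open>L * D \<le> D / \<eta>\<close>; the error of \<open>g\<close>; the scaled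
  step, at most \<open>D / \<eta>\<close>; and the proximal subgradient, at most
  \<open>\<rho> * D / \<eta>\<close>. Hence the factor \<open>\<rho> + 2\<close>.\<close>

lemma infdist0_prox_step_le:
  fixes X :: "(real^'n) set" and x g :: "real^'n"
  assumes X: "convex X" and \<rho>: "0 \<le> \<rho>" and \<eta>: "0 < \<eta>" "\<eta> \<le> 1 / L" and L: "0 < L"
    and grad: "\<And>u. GDERIV f u :> gradf u"
    and lip: "\<And>u v. u \<in> X \<Longrightarrow> v \<in> X \<Longrightarrow> infnorm (gradf u - gradf v) \<le> L * l1norm (u - v)"
    and x: "x \<in> X" and min: "is_arg_min (prox_obj \<rho> x (x - \<eta> *\<^sub>R g)) (\<lambda>u. u \<in> X) v"
  shows "infdist0 (frechet_subdiff (\<lambda>u. ereal (f u) + delta X u) v)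
    \<le> ennreal ((\<rho> + 2) * l1norm (v - x) / \<eta> + infnorm (g - gradf x))"
proof -
  define D where "D = l1norm (v - x)"
  have v: "v \<in> X" using min by (simp add: is_arg_min_def)
  obtain c where c: "infnorm c \<le> \<rho> * D"
    and normal: "\<And>u. u \<in> X \<Longrightarrow> 0 \<le> (v - (x - \<eta> *\<^sub>R g) - c) \<bullet> (u - v)"
    using prox_normal_vector[OF X \<rho> min] unfolding D_def by metis
  \<comment> \<open>The optimality condition of the step, divided by \<open>- \<eta>\<close> to give
    an outward normal at \<open>v\<close>.\<close>
  define n where "n = (- 1 / \<eta>) *\<^sub>R (v - (x - \<eta> *\<^sub>R g) - c)"
  have "gradf v + n \<in> frechet_subdiff (\<lambda>u. ereal (f u) + delta X u) v"
    using normal \<eta>(1) v grad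
    by (intro frechet_subdiff_memI) (auto simp: n_def)
  then have "infdist0 (frechet_subdiff (\<lambda>u. ereal (f u) + delta X u) v) \<le> ennreal (infnorm (gradf v + n))"
    unfolding infdist0_def by (rule INF_lower)
  also have "infnorm (gradf v + n) \<le> (\<rho> + 2) * D / \<eta> + infnorm (g - gradf x)"
  proof -
    have eq: "gradf v + n = (gradf v - gradf x) + - (g - gradf x) + (- 1 / \<eta>) *\<^sub>R (v - x) + (1 / \<eta>) *\<^sub>R c"
      using \<eta>(1) by (simp add: n_def algebra_simps)
    have "infnorm (gradf v + n) \<le> infnorm (gradf v - gradf x) + infnorm (g - gradf x)
        + infnorm ((- 1 / \<eta>) *\<^sub>R (v - x)) + infnorm ((1 / \<eta>) *\<^sub>R c)"
      using infnorm_triangle[of "gradf v - gradf x" "- (g - gradf x)"]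
        infnorm_triangle[of "(gradf v - gradf x) + - (g - gradf x)" "(- 1 / \<eta>) *\<^sub>R (v - x)"]
        infnorm_triangle[of "(gradf v - gradf x) + - (g - gradf x) + (- 1 / \<eta>) *\<^sub>R (v - x)" "(1 / \<eta>) *\<^sub>R c"]
      unfolding eq infnorm_neg by linarith
    moreover have "infnorm (gradf v - gradf x) \<le> D / \<eta>"
    proof -
      have "L \<le> 1 / \<eta>" using \<eta> L by (simp add: field_simps)
      then have "L * D \<le> 1 / \<eta> * D" by (intro mult_right_mono) (auto simp: D_def)
      with lip[OF v x] show ?thesis by (simp add: D_def)
    qed
    moreover have "infnorm ((- 1 / \<eta>) *\<^sub>R (v - x)) \<le> D / \<eta>"
      unfolding infnorm_mul using infnorm_le_l1norm[of "v - x"] \<eta>(1) by (simp add: D_def divide_right_mono)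
    moreover have "infnorm ((1 / \<eta>) *\<^sub>R c) \<le> \<rho> * D / \<eta>"
      using c \<eta>(1) by (simp add: infnorm_mul divide_right_mono)
    moreover have "(\<rho> + 2) * D / \<eta> = D / \<eta> + D / \<eta> + \<rho> * D / \<eta>"
      by (simp add: add_divide_distrib algebra_simps)
    ultimately show ?thesis by linarith
  qed
  finally show ?thesis by (simp add: D_def ennreal_leI)
qed

text \<open>Optimality tested at \<open>x\<close> gives a decrease of
  \<open>\<rho> * D\<^sup>2 / \<eta>\<close>. The error term spends a quarter of it, the curvature
  \<open>L / 2 \<le> 1 / (2 * \<eta>)\<close> another \<open>D\<^sup>2 / (2 * \<eta>)\<close>; what
  remains is the coefficient \<open>3 * \<rho> / 4 - 1 / 2\<close>.\<close>

lemma prox_step_descent: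
  fixes X :: "(real^'n) set" and x g :: "real^'n"
  assumes X: "convex X" and \<rho>: "0 < \<rho>" and \<eta>: "0 < \<eta>" "\<eta> \<le> 1 / L" and L: "0 < L"
    and grad: "\<And>u. GDERIV f u :> gradf u"
    and lip: "\<And>u v. u \<in> X \<Longrightarrow> v \<in> X \<Longrightarrow> infnorm (gradf u - gradf v) \<le> L * l1norm (u - v)"
    and x: "x \<in> X" and min: "is_arg_min (prox_obj \<rho> x (x - \<eta> *\<^sub>R g)) (\<lambda>u. u \<in> X) v"
  shows "(3 * \<rho> / 4 - 1 / 2) * ((l1norm (v - x))\<^sup>2 / \<eta>) \<le> f x - f v + \<eta> / \<rho> * (infnorm (g - gradf x))\<^sup>2"
proof -
  define D w where "D = l1norm (v - x)" and "w = infnorm (g - gradf x)"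
  have v: "v \<in> X" using min by (simp add: is_arg_min_def)
  have "0 \<le> (v - (x - \<eta> *\<^sub>R g)) \<bullet> (x - v) - \<rho> * D\<^sup>2"
    using prox_first_order[OF X _ min x] \<rho> by (simp add: D_def power2_eq_square)
  moreover have "(v - (x - \<eta> *\<^sub>R g)) \<bullet> (x - v) = - ((v - x) \<bullet> (v - x)) - \<eta> * (g \<bullet> (v - x))"
    by (simp add: inner_diff_left inner_diff_right inner_commute algebra_simps)
  ultimately have "\<eta> * (g \<bullet> (v - x)) \<le> - \<rho> * D\<^sup>2"
    using inner_ge_zero[of "v - x"] by linarith
  then have 1: "g \<bullet> (v - x) \<le> - \<rho> * D\<^sup>2 / \<eta>"
    using \<eta>(1) by (simp add: field_simps)
  have 2: "- ((g - gradf x) \<bullet> (v - x)) \<le> w * D"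
    using abs_inner_le_infnorm_l1norm[of "g - gradf x" "v - x"] by (simp add: w_def D_def abs_le_iff)
  \<comment> \<open>Young's inequality, weighted so that a quarter of \<open>\<rho>\<close> is used
    up.\<close>
  have 3: "w * D \<le> \<rho> / 4 * (D\<^sup>2 / \<eta>) + \<eta> / \<rho> * w\<^sup>2"
  proof -
    have "0 \<le> (\<rho> * D - 2 * \<eta> * w)\<^sup>2 / (4 * \<rho> * \<eta>)" using \<rho> \<eta>(1) by simp
    also have "\<dots> = \<rho> / 4 * (D\<^sup>2 / \<eta>) + \<eta> / \<rho> * w\<^sup>2 - w * D"
      using \<rho> \<eta>(1) by (simp add: field_simps power2_eq_square)
    finally show ?thesis by simp
  qed
  have "L \<le> 1 / \<eta>" using \<eta> L by (simp add: field_simps)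
  then have "L / 2 * D\<^sup>2 \<le> (1 / \<eta>) / 2 * D\<^sup>2" by (intro mult_right_mono) auto
  with descent_inequality[OF X grad lip x v] 1 2 3
  have "f v \<le> f x - \<rho> * D\<^sup>2 / \<eta> + (\<rho> / 4 * (D\<^sup>2 / \<eta>) + \<eta> / \<rho> * w\<^sup>2) + (1 / \<eta>) / 2 * D\<^sup>2"
    by (simp add: D_def inner_diff_left)
  moreover have "(3 * \<rho> / 4 - 1 / 2) * (D\<^sup>2 / \<eta>) = \<rho> * D\<^sup>2 / \<eta> - \<rho> / 4 * (D\<^sup>2 / \<eta>) - (1 / \<eta>) / 2 * D\<^sup>2"
    using \<eta>(1) by (simp add: field_simps)
  ultimately show ?thesis unfolding D_def w_def by linarith
qed

subsection \<open>A type-2 inequality for the maximum norm\<close>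

text \<open>The potential is the squared \<open>2q\<close>-norm, smoothed by an additive constant \<open>\<epsilon>\<close> that makes it twice
  differentiable also at the origin.\<close>

definition smooth_sq :: "nat \<Rightarrow> real \<Rightarrow> real^'n \<Rightarrow> real" where
  "smooth_sq q \<epsilon> x = (\<epsilon> + (\<Sum>i\<in>UNIV. (x $ i) ^ (2 * q))) powr (1 / real q)"

definition smooth_sq_grad :: "nat \<Rightarrow> real \<Rightarrow> real^'n \<Rightarrow> real^'n" where
  "smooth_sq_grad q \<epsilon> x = (\<chi> j. 2 * (\<epsilon> + (\<Sum>i\<in>UNIV. (x $ i) ^ (2 * q))) powr (1 / real q - 1) * (x $ j) ^ (2 * q - 1))"

lemma even_power_sum_nonneg [simp]: "0 \<le> (\<Sum>i\<in>UNIV. ((x :: real^'n) $ i) ^ (2 * q))"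
  by (intro sum_nonneg) (simp add: power_mult)

lemma smooth_sq_nonneg [simp]: "0 \<le> smooth_sq q \<epsilon> x"
  by (simp add: smooth_sq_def)

lemma infnorm_sq_le_smooth_sq:
  fixes x :: "real^'n"
  assumes q: "0 < q" and \<epsilon>: "0 \<le> \<epsilon>"
  shows "(infnorm x)\<^sup>2 \<le> smooth_sq q \<epsilon> x"
proof -
  have "\<bar>x $ i\<bar> \<le> sqrt (smooth_sq q \<epsilon> x)" for i
  proof -
    have "(x $ i) ^ (2 * q) \<le> (\<Sum>i\<in>UNIV. (x $ i) ^ (2 * q))"
      by (rule member_le_sum) (auto simp: power_mult)
    then have "((x $ i)\<^sup>2) ^ q \<le> \<epsilon> + (\<Sum>i\<in>UNIV. (x $ i) ^ (2 * q))"
      using \<epsilon> by (simp add: power_mult)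
    then have "(((x $ i)\<^sup>2) ^ q) powr (1 / real q) \<le> smooth_sq q \<epsilon> x"
      unfolding smooth_sq_def by (intro powr_mono2) auto
    moreover have "(((x $ i)\<^sup>2) ^ q) powr (1 / real q) = (x $ i)\<^sup>2"
    proof (cases "x $ i = 0")
      case False
      then show ?thesis using q by (simp add: powr_realpow[symmetric] powr_powr)
    qed (use q in simp)
    ultimately show ?thesis by (metis real_sqrt_abs real_sqrt_le_mono)
  qed
  then have "infnorm x \<le> sqrt (smooth_sq q \<epsilon> x)" by (rule infnorm_le)
  then have "(infnorm x)\<^sup>2 \<le> (sqrt (smooth_sq q \<epsilon> x))\<^sup>2" by (intro power_mono) auto
  then show ?thesis by simp
qed

text \<open>Young's inequality with exponents \<open>q / (q - 1)\<close> and \<open>q\<close>, read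
  off from Bernoulli's inequality at \<open>s / c\<close>.\<close>

lemma young_power:
  fixes c s :: real
  assumes "0 < q" "0 \<le> c" "0 \<le> s"
  shows "c ^ (q - 1) * s \<le> ((real q - 1) * c ^ q + s ^ q) / real q"
proof (cases "q = 1 \<or> c = 0")
  case True
  then show ?thesis using assms by (cases "q = 1") (auto simp: power_0_left)
next
  case False
  then have c: "0 < c" and q: "q \<ge> 1" using assms by auto
  have "1 + real q * (s / c - 1) \<le> (1 + (s / c - 1)) ^ q"
    using c assms by (intro Bernoulli_inequality) auto
  then have "c ^ q * (1 + real q * (s / c - 1)) \<le> c ^ q * (s / c) ^ q"
    using c by (intro mult_left_mono) auto
  also have "c ^ q * (s / c) ^ q = s ^ q" using c by (simp add: power_divide)
  finally have *: "c ^ q * (1 + real q * (s / c - 1)) \<le> s ^ q" .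
  have "c ^ q = c * c ^ (q - 1)" using assms(1) by (simp add: power_eq_if)
  then have "c ^ q * (1 + real q * (s / c - 1)) = real q * (c ^ (q - 1) * s) - (real q - 1) * c ^ q"
    using c by (simp add: field_simps)
  with * show ?thesis using assms(1) by (simp add: field_simps)
qed

text \<open>With \<open>a\<close> the \<open>q\<close>-th root of \<open>\<Phi>\<close>, the
  \<open>q\<close>-th powers of the numbers \<open>(x $ i)\<^sup>2 / a\<close> sum to at most 1. By
  comparison of power means their \<open>(q - 1)\<close>-th powers then sum to at most
  \<open>d powr (1 / q)\<close>.\<close>

lemma smooth_sq_hessian_bound:
  fixes x y :: "real^'n"
  assumes q: "0 < q" and \<epsilon>: "0 < \<epsilon>"
  defines "\<Phi> \<equiv> \<epsilon> + (\<Sum>i\<in>UNIV. (x $ i) ^ (2 * q))"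
  shows "\<Phi> powr (1 / real q - 1) * (\<Sum>i\<in>UNIV. (x $ i) ^ (2 * q - 2) * (y $ i)\<^sup>2)
    \<le> real CARD('n) powr (1 / real q) * (infnorm y)\<^sup>2"
proof -
  define d where "d = real CARD('n)"
  have d: "0 < d" by (simp add: d_def)
  have \<Phi>: "0 < \<Phi>" using \<epsilon> by (simp add: \<Phi>_def add_pos_nonneg)
  define a where "a = \<Phi> powr (1 / real q)"
  have a: "0 < a" using \<Phi> by (simp add: a_def)
  have aq: "a ^ q = \<Phi>" using \<Phi> q by (simp add: a_def powr_realpow[symmetric] powr_powr)
  have a': "\<Phi> powr (1 / real q - 1) = 1 / a ^ (q - 1)"
  proof -
    have "\<Phi> powr (1 / real q - 1) = a / \<Phi>" using \<Phi> by (simp add: a_def powr_diff)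
    also have "\<dots> = 1 / a ^ (q - 1)"
      using a q by (simp add: aq[symmetric] power_eq_if)
    finally show ?thesis .
  qed
  \<comment> \<open>This weight satisfies \<open>d * s ^ q = 1\<close>, so the Young bounds sum to
    at most \<open>((q - 1) + 1) / q = 1\<close>.\<close>
  define s where "s = d powr (- 1 / real q)"
  have s: "0 < s" using d by (simp add: s_def)
  have "s ^ q = s powr real q" using s by (simp add: powr_realpow)
  also have "\<dots> = d powr (- 1)" unfolding s_def powr_powr using q by simp
  finally have sq: "s ^ q = 1 / d" using d by (simp add: powr_minus divide_inverse)
  have "s * (\<Sum>i\<in>UNIV. ((x $ i)\<^sup>2 / a) ^ (q - 1))
      = (\<Sum>i\<in>UNIV. ((x $ i)\<^sup>2 / a) ^ (q - 1) * s)"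
    by (simp add: sum_distrib_left mult.commute)
  also have "\<dots> \<le> (\<Sum>i\<in>(UNIV::'n set). ((real q - 1) * ((x $ i)\<^sup>2 / a) ^ q + s ^ q) / real q)"
    using q a s by (intro sum_mono young_power) auto
  also have "\<dots> = ((real q - 1) * ((\<Sum>i\<in>UNIV. (x $ i) ^ (2 * q)) / \<Phi>) + 1) / real q"
    by (simp add: sum_divide_distrib[symmetric] sum.distrib sum_distrib_left[symmetric] power_divide aq
      power_mult[symmetric] sq d_def)
  also have "\<dots> \<le> ((real q - 1) * 1 + 1) / real q"
    using q \<epsilon> \<Phi> by (intro divide_right_mono add_right_mono mult_left_mono) (auto simp: \<Phi>_def)
  also have "\<dots> = 1" using q by simp
  finally have "(\<Sum>i\<in>UNIV. ((x $ i)\<^sup>2 / a) ^ (q - 1)) \<le> 1 / s" using s by (simp add: field_simps)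
  also have "1 / s = d powr (1 / real q)" using d by (simp add: s_def powr_minus divide_inverse)
  finally have 1: "(\<Sum>i\<in>UNIV. ((x $ i)\<^sup>2 / a) ^ (q - 1)) \<le> d powr (1 / real q)" .
  have eq: "2 * q - 2 = 2 * (q - 1)" by simp
  have "(\<Sum>i\<in>UNIV. (x $ i) ^ (2 * q - 2) * (y $ i)\<^sup>2)
      \<le> (\<Sum>i\<in>UNIV. (x $ i) ^ (2 * q - 2) * (infnorm y)\<^sup>2)"
    unfolding eq
    by (intro sum_mono mult_left_mono) (auto simp: power_mult abs_le_square_iff[symmetric] component_le_infnorm_cart)
  then have "\<Phi> powr (1 / real q - 1) * (\<Sum>i\<in>UNIV. (x $ i) ^ (2 * q - 2) * (y $ i)\<^sup>2)
      \<le> \<Phi> powr (1 / real q - 1) * (\<Sum>i\<in>UNIV. (x $ i) ^ (2 * q - 2) * (infnorm y)\<^sup>2)"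
    by (intro mult_left_mono) auto
  also have "\<dots> = (\<Sum>i\<in>UNIV. ((x $ i)\<^sup>2 / a) ^ (q - 1)) * (infnorm y)\<^sup>2"
    unfolding eq a' by (simp add: sum_distrib_right[symmetric] power_divide sum_divide_distrib[symmetric] power_mult)
  also have "\<dots> \<le> d powr (1 / real q) * (infnorm y)\<^sup>2" using 1 by (intro mult_right_mono) auto
  finally show ?thesis by (simp add: d_def)
qed

text \<open>Second-order Taylor expansion along the segment from \<open>x\<close> to
  \<open>x + y\<close>; \<open>h1\<close> and \<open>h2\<close> are the derivatives of the potential
  in the segment parameter.\<close>

lemma smooth_sq_add_le:
  fixes x y :: "real^'n"
  assumes q: "0 < q" and \<epsilon>: "0 < \<epsilon>"
  shows "smooth_sq q \<epsilon> (x + y) \<le> smooth_sq q \<epsilon> x + smooth_sq_grad q \<epsilon> x \<bullet> y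
    + (2 * real q - 1) * real CARD('n) powr (1 / real q) * (infnorm y)\<^sup>2"
proof -
  define \<Phi> where "\<Phi> t = \<epsilon> + (\<Sum>i\<in>UNIV. (x $ i + t * y $ i) ^ (2 * q))" for t
  define \<Phi>1 where "\<Phi>1 t = (\<Sum>i\<in>UNIV. (x $ i + t * y $ i) ^ (2 * q - 1) * y $ i)" for t
  define \<Phi>2 where "\<Phi>2 t = (\<Sum>i\<in>UNIV. (x $ i + t * y $ i) ^ (2 * q - 2) * (y $ i)\<^sup>2)" for t
  define C where "C = (2 * real q - 1) * real CARD('n) powr (1 / real q) * (infnorm y)\<^sup>2"
  have pos: "0 < \<Phi> t" for t
    using \<epsilon> even_power_sum_nonneg[of "x + t *\<^sub>R y" q] by (simp add: \<Phi>_def add_pos_nonneg)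
  have d\<Phi>: "(\<Phi> has_real_derivative 2 * real q * \<Phi>1 t) (at t)" for t
    unfolding \<Phi>_def \<Phi>1_def
    by (auto intro!: derivative_eq_intros simp: sum_distrib_left mult_ac)
  have d\<Phi>1: "(\<Phi>1 has_real_derivative (2 * real q - 1) * \<Phi>2 t) (at t)" for t
  proof -
    have e: "q * 2 - Suc (Suc 0) = q * 2 - 2" by simp
    show ?thesis
      unfolding \<Phi>1_def \<Phi>2_def using q
      by (auto intro!: derivative_eq_intros simp: sum_distrib_left mult_ac of_nat_diff power2_eq_square e)
  qed
  define h0 h1 h2 where "h0 t = \<Phi> t powr (1 / real q)"
    and "h1 t = 2 * \<Phi> t powr (1 / real q - 1) * \<Phi>1 t"
    and "h2 t = 4 * (1 - real q) * \<Phi> t powr (1 / real q - 2) * (\<Phi>1 t)\<^sup>2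
       + 2 * (2 * real q - 1) * (\<Phi> t powr (1 / real q - 1) * \<Phi>2 t)" for t
  have dh0: "(h0 has_real_derivative h1 t) (at t)" for t
    unfolding h0_def[abs_def]
    by (rule derivative_eq_intros d\<Phi> pos refl)+
      (use pos[of t] q in \<open>simp add: h1_def powr_diff field_simps\<close>)
  have dh1: "(h1 has_real_derivative h2 t) (at t)" for t
    unfolding h1_def[abs_def]
    by (rule derivative_eq_intros d\<Phi> d\<Phi>1 pos refl)+
      (use pos[of t] q in \<open>simp add: h2_def powr_diff power2_eq_square field_simps\<close>)
  have h2_le: "h2 t \<le> 2 * C" for t
  proof -
    have "4 * (1 - real q) * \<Phi> t powr (1 / real q - 2) * (\<Phi>1 t)\<^sup>2 \<le> 0"
      using q by (intro mult_nonpos_nonneg[OF mult_nonpos_nonneg]) auto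
    moreover have "\<Phi> t powr (1 / real q - 1) * \<Phi>2 t \<le> real CARD('n) powr (1 / real q) * (infnorm y)\<^sup>2"
      using smooth_sq_hessian_bound[OF q \<epsilon>, of "x + t *\<^sub>R y" y] by (simp add: \<Phi>_def \<Phi>2_def)
    then have "2 * (2 * real q - 1) * (\<Phi> t powr (1 / real q - 1) * \<Phi>2 t)
        \<le> 2 * (2 * real q - 1) * (real CARD('n) powr (1 / real q) * (infnorm y)\<^sup>2)"
      using q by (intro mult_left_mono) auto
    ultimately have "h2 t \<le> 2 * (2 * real q - 1) * (real CARD('n) powr (1 / real q) * (infnorm y)\<^sup>2)"
      unfolding h2_def by linarith
    then show ?thesis by (simp only: C_def mult.assoc)
  qed
  define diff where "diff n = (if n = 0 then h0 else if n = 1 then h1 else h2)" for n :: nat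
  have "\<exists>t. 0 < t \<and> t < 1 \<and>
      h0 1 = (\<Sum>m<2. diff m 0 / fact m * (1 - 0) ^ m) + diff 2 t / fact 2 * (1 - 0) ^ 2"
    by (rule Taylor_up) (auto simp: diff_def dh0 dh1 less_2_cases_iff)
  then obtain t where "h0 1 = h0 0 + h1 0 + h2 t / 2"
    by (auto simp: diff_def numeral_2_eq_2)
  with h2_le[of t] have "h0 1 \<le> h0 0 + h1 0 + C" by simp
  moreover have "h1 0 = (\<Sum>i\<in>UNIV. 2 * \<Phi> 0 powr (1 / real q - 1) * (x $ i) ^ (2 * q - 1) * y $ i)"
    by (simp only: h1_def \<Phi>1_def sum_distrib_left mult_zero_left add_0_right mult.assoc)
  then have "h1 0 = smooth_sq_grad q \<epsilon> x \<bullet> y"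
    by (simp add: smooth_sq_grad_def inner_vec_def \<Phi>_def)
  ultimately show ?thesis
    by (simp add: h0_def \<Phi>_def smooth_sq_def C_def)
qed

lemma measurable_smooth_sq [measurable]: "smooth_sq q \<epsilon> \<in> borel_measurable borel"
  unfolding smooth_sq_def by measurable

lemma infnorm_measurable [measurable]: "infnorm \<in> borel_measurable borel"
  by (intro borel_measurable_continuous_onI continuous_intros)

lemma l1norm_measurable [measurable]: "l1norm \<in> borel_measurable borel"
  by (intro borel_measurable_continuous_onI continuous_intros)

text \<open>Centring removes the linear term of \<open>smooth_sq_add_le\<close>. The quadratic
  coefficient does not depend on \<open>x\<close>, so the increments can be accumulated over a
  sum.\<close>

lemma smooth_sq_centered_increment:
  fixes H :: "'b \<Rightarrow> real^'n"
  assumes D: "prob_space D" and q: "0 < q" and \<epsilon>: "0 < \<epsilon>"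
    and H: "integrable D H" "(\<integral>z. H z \<partial>D) = 0"
    and var: "(\<integral>\<^sup>+z. ennreal ((infnorm (H z))\<^sup>2) \<partial>D) \<le> ennreal s" and s: "0 \<le> s"
  shows "(\<integral>\<^sup>+z. ennreal (smooth_sq q \<epsilon> (x + H z)) \<partial>D)
    \<le> ennreal (smooth_sq q \<epsilon> x + (2 * real q - 1) * real CARD('n) powr (1 / real q) * s)"
proof -
  interpret D: prob_space D by fact
  define C where "C = (2 * real q - 1) * real CARD('n) powr (1 / real q)"
  have C: "0 \<le> C" using q by (simp add: C_def)
  have [measurable]: "H \<in> borel_measurable D" using H by auto
  define W where "W z = (infnorm (H z))\<^sup>2" for z
  have [measurable]: "W \<in> borel_measurable D"
    unfolding W_def[abs_def] by measurable
  have W: "integrable D W"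
  proof (rule integrableI_nonneg)
    have "(\<integral>\<^sup>+z. ennreal (W z) \<partial>D) \<le> ennreal s" using var by (simp add: W_def)
    also have "\<dots> < \<infinity>" by simp
    finally show "(\<integral>\<^sup>+z. ennreal (W z) \<partial>D) < \<infinity>" .
  qed (auto simp: W_def)
  have W_le: "(\<integral>z. W z \<partial>D) \<le> s"
  proof -
    have "ennreal (\<integral>z. W z \<partial>D) = (\<integral>\<^sup>+z. ennreal (W z) \<partial>D)"
      by (rule nn_integral_eq_integral[OF W, symmetric]) (simp add: W_def)
    then have "ennreal (\<integral>z. W z \<partial>D) \<le> ennreal s" using var by (simp only: W_def)
    then show ?thesis using s by (simp only: ennreal_le_iff)
  qed
  have g: "integrable D (\<lambda>z. smooth_sq_grad q \<epsilon> x \<bullet> H z)"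
    "(\<integral>z. smooth_sq_grad q \<epsilon> x \<bullet> H z \<partial>D) = 0"
    using H by auto
  define R where "R z = smooth_sq q \<epsilon> x + smooth_sq_grad q \<epsilon> x \<bullet> H z + C * W z" for z
  have R: "smooth_sq q \<epsilon> (x + H z) \<le> R z" for z
    using smooth_sq_add_le[OF q \<epsilon>] by (simp add: R_def C_def W_def)
  \<comment> \<open>Nonnegativity turns the nonnegative integral of the majorant into a Bochner
    integral, in which the linear term cancels.\<close>
  have R0: "0 \<le> R z" for z using R[of z] smooth_sq_nonneg order_trans by blast
  have "(\<integral>\<^sup>+z. ennreal (smooth_sq q \<epsilon> (x + H z)) \<partial>D) \<le> (\<integral>\<^sup>+z. ennreal (R z) \<partial>D)"
    using R by (intro nn_integral_mono ennreal_leI)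
  also have "\<dots> = ennreal (\<integral>z. R z \<partial>D)"
    unfolding R_def using g W R0 by (intro nn_integral_eq_integral) (auto simp: R_def)
  also have "(\<integral>z. R z \<partial>D) = smooth_sq q \<epsilon> x + C * (\<integral>z. W z \<partial>D)"
    unfolding R_def using g W by (simp add: D.prob_space)
  also have "ennreal (smooth_sq q \<epsilon> x + C * (\<integral>z. W z \<partial>D)) \<le> ennreal (smooth_sq q \<epsilon> x + C * s)"
    using W_le C by (intro ennreal_leI add_left_mono mult_left_mono)
  finally show ?thesis by (simp add: C_def)
qed

text \<open>Induction on the index set: the new coordinate is integrated first, with the partial sum
  of the others in the role of \<open>x\<close>.\<close>

lemma smooth_sq_sum_le:
  fixes H :: "'b \<Rightarrow> real^'n"
  assumes D: "prob_space D" and q: "0 < q" and \<epsilon>: "0 < \<epsilon>"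
    and H: "integrable D H" "(\<integral>z. H z \<partial>D) = 0"
    and var: "(\<integral>\<^sup>+z. ennreal ((infnorm (H z))\<^sup>2) \<partial>D) \<le> ennreal s" and s: "0 \<le> s"
    and J: "finite J"
  shows "(\<integral>\<^sup>+z. ennreal (smooth_sq q \<epsilon> (\<Sum>j\<in>J. H (z j))) \<partial>Pi\<^sub>M J (\<lambda>_. D))
    \<le> ennreal (smooth_sq q \<epsilon> (0 :: real^'n) + real (card J) * ((2 * real q - 1) * real CARD('n) powr (1 / real q) * s))"
proof -
  interpret D: prob_space D by fact
  interpret P: product_sigma_finite "\<lambda>_. D" by standard
  define C where "C = (2 * real q - 1) * real CARD('n) powr (1 / real q) * s"
  have C: "0 \<le> C" using q s by (simp add: C_def)
  have [measurable]: "H \<in> borel_measurable D" using H by auto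
  show ?thesis
    unfolding C_def[symmetric] using J
  proof (induction J)
    case empty
    interpret PE: prob_space "Pi\<^sub>M {} (\<lambda>_. D)" by (intro prob_space_PiM D)
    show ?case by (simp add: PE.emeasure_space_1)
  next
    case (insert i J)
    interpret PJ: prob_space "Pi\<^sub>M J (\<lambda>_. D)" by (intro prob_space_PiM D)
    have "(\<integral>\<^sup>+z. ennreal (smooth_sq q \<epsilon> (\<Sum>j\<in>insert i J. H (z j))) \<partial>Pi\<^sub>M (insert i J) (\<lambda>_. D))
        = (\<integral>\<^sup>+z. \<integral>\<^sup>+y. ennreal (smooth_sq q \<epsilon> (\<Sum>j\<in>insert i J. H ((z(i := y)) j))) \<partial>D \<partial>Pi\<^sub>M J (\<lambda>_. D))"
      using insert.hyps by (intro P.product_nn_integral_insert) auto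
    also have "\<dots> = (\<integral>\<^sup>+z. \<integral>\<^sup>+y. ennreal (smooth_sq q \<epsilon> ((\<Sum>j\<in>J. H (z j)) + H y)) \<partial>D \<partial>Pi\<^sub>M J (\<lambda>_. D))"
    proof -
      have "(\<Sum>j\<in>insert i J. H ((z(i := y)) j)) = (\<Sum>j\<in>J. H (z j)) + H y" for z y
      proof -
        have "(\<Sum>j\<in>J. H ((z(i := y)) j)) = (\<Sum>j\<in>J. H (z j))"
          using insert.hyps by (intro sum.cong) auto
        then show ?thesis using insert.hyps by (simp add: add.commute)
      qed
      then show ?thesis by simp
    qed
    also have "\<dots> \<le> (\<integral>\<^sup>+z. ennreal (smooth_sq q \<epsilon> (\<Sum>j\<in>J. H (z j))) + ennreal C \<partial>Pi\<^sub>M J (\<lambda>_. D))"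
      using smooth_sq_centered_increment[OF D q \<epsilon> H var s] C
      by (intro nn_integral_mono) (simp add: C_def ennreal_plus[symmetric] del: ennreal_plus)
    also have "\<dots> = (\<integral>\<^sup>+z. ennreal (smooth_sq q \<epsilon> (\<Sum>j\<in>J. H (z j))) \<partial>Pi\<^sub>M J (\<lambda>_. D)) + ennreal C"
      by (subst nn_integral_add) (auto simp: PJ.emeasure_space_1)
    also have "\<dots> \<le> ennreal (smooth_sq q \<epsilon> (0 :: real^'n) + real (card J) * C) + ennreal C"
      using insert.IH by (intro add_right_mono)
    also have "\<dots> = ennreal (smooth_sq q \<epsilon> (0 :: real^'n) + real (card (insert i J)) * C)"
      using insert.hyps C by (simp add: ennreal_plus[symmetric] algebra_simps del: ennreal_plus)
    finally show ?case .
  qed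
qed

text \<open>For \<open>d \<ge> 8\<close> take \<open>q\<close> to be \<open>ln d\<close> rounded up:
  then \<open>d powr (1 / q) \<le> e\<close>, and \<open>2 * q - 1 \<le> 2 * ln d + 1 \<le> 5 / 2 *
  ln d \<le> e * ln d\<close>, since \<open>ln d \<ge> 2\<close>. For smaller \<open>d\<close> the
  choice \<open>q = 1\<close> has constant \<open>d\<close>; the estimates
  \<open>e\<^sup>2 \<ge> 25 / 4\<close> and \<open>ln 2 \<ge> 2 / 3\<close> give
  \<open>25 / 6\<close> for \<open>d \<le> 3\<close> and \<open>25 / 3\<close> for
  \<open>4 \<le> d \<le> 8\<close>.\<close>

lemma type2_constant:
  assumes d: "2 \<le> d"
  obtains q :: nat where "0 < q" "(2 * real q - 1) * real d powr (1 / real q) \<le> (exp 1)\<^sup>2 * ln (real d)"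
proof -
  have e: "(5/2 :: real) \<le> exp 1"
    using exp_lower_Taylor_quadratic[of 1] by simp
  then have "(5/2)\<^sup>2 \<le> (exp 1 :: real)\<^sup>2" by (intro power_mono) auto
  then have e2: "25/4 \<le> (exp 1 :: real)\<^sup>2" by (simp add: power2_eq_square)
  have ln2: "2/3 \<le> ln (2::real)" by (rule ln2_ge_two_thirds)
  have ln_mono: "ln a \<le> ln (real d)" if "0 < a" "a \<le> real d" for a
    using that by simp
  have sq: "25/4 * a \<le> (exp 1)\<^sup>2 * ln (real d)" if "0 \<le> a" "a \<le> ln (real d)" for a
    using e2 that by (intro mult_mono) auto
  consider "d \<le> 3" | "4 \<le> d" "d \<le> 8" | "8 \<le> d" by linarith
  then show ?thesis
  proof cases
    case 1
    have "25/4 * (2/3) \<le> (exp 1)\<^sup>2 * ln (real d)"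
      using ln2 ln_mono[of 2] d by (intro sq) linarith+
    then show ?thesis using 1 d by (intro that[of 1]) auto
  next
    case 2
    have "ln (2 ^ 2 :: real) = 2 * ln 2" by (subst ln_realpow) auto
    then have "25/4 * (4/3) \<le> (exp 1)\<^sup>2 * ln (real d)"
      using ln2 ln_mono[of 4] 2 by (intro sq) simp_all
    then show ?thesis using 2 by (intro that[of 1]) auto
  next
    case 3
    have "ln (2 ^ 3 :: real) = 3 * ln 2" by (subst ln_realpow) auto
    then have l: "2 \<le> ln (real d)" using ln2 ln_mono[of 8] 3 by auto
    define q where "q = nat \<lceil>ln (real d)\<rceil>"
    have q: "ln (real d) \<le> real q" "real q \<le> ln (real d) + 1" "0 < q"
      using l by (auto simp: q_def)
    have "real d powr (1 / real q) = exp (ln (real d) / real q)"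
      using 3 by (simp add: powr_def)
    also have "\<dots> \<le> exp 1" using q by (simp add: divide_le_eq)
    finally have "(2 * real q - 1) * real d powr (1 / real q) \<le> (2 * ln (real d) + 1) * exp 1"
      using q l by (intro mult_mono) auto
    also have "\<dots> \<le> (ln (real d) * (5/2)) * exp 1"
      using l by (intro mult_right_mono) auto
    also have "\<dots> \<le> (ln (real d) * exp 1) * exp 1"
      using e l by (intro mult_right_mono mult_left_mono) auto
    finally show ?thesis using q by (intro that[of q]) (auto simp: power2_eq_square algebra_simps)
  qed
qed

text \<open>Growth is linear in the number of summands, so dividing by the squared batch size later
  leaves \<open>1 / m\<close>.\<close>

lemma minibatch_variance:
  fixes H :: "'b \<Rightarrow> real^'n"
  assumes D: "prob_space D" and dim: "2 \<le> CARD('n)"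
    and H: "integrable D H" "(\<integral>z. H z \<partial>D) = 0"
    and var: "(\<integral>\<^sup>+z. ennreal ((infnorm (H z))\<^sup>2) \<partial>D) \<le> ennreal s" and s: "0 \<le> s"
    and J: "finite J"
  shows "(\<integral>\<^sup>+z. ennreal ((infnorm (\<Sum>j\<in>J. H (z j)))\<^sup>2) \<partial>Pi\<^sub>M J (\<lambda>_. D))
    \<le> ennreal (real (card J) * ((exp 1)\<^sup>2 * ln (real CARD('n)) * s))"
proof -
  obtain q :: nat where q: "0 < q"
    and le: "(2 * real q - 1) * real CARD('n) powr (1 / real q) \<le> (exp 1)\<^sup>2 * ln (real CARD('n))"
    using type2_constant[OF dim] by blast
  define C where "C = (2 * real q - 1) * real CARD('n) powr (1 / real q) * s"
  let ?I = "\<integral>\<^sup>+z. ennreal ((infnorm (\<Sum>j\<in>J. H (z j)))\<^sup>2) \<partial>Pi\<^sub>M J (\<lambda>_. D)"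
  have C: "0 \<le> C" using q s by (simp add: C_def)
  \<comment> \<open>The smoothing parameter \<open>e ^ q\<close> makes the potential at the origin
    equal to \<open>e\<close>, the only cost of smoothing.\<close>
  have "?I \<le> ennreal (real (card J) * C + e)" if e: "0 < e" for e
  proof -
    have pw: "0 < e ^ q" "(e ^ q) powr (1 / real q) = e"
      using e q by (simp_all add: powr_realpow[symmetric] powr_powr)
    have "?I \<le> (\<integral>\<^sup>+z. ennreal (smooth_sq q (e ^ q) (\<Sum>j\<in>J. H (z j))) \<partial>Pi\<^sub>M J (\<lambda>_. D))"
      using q pw by (intro nn_integral_mono ennreal_leI infnorm_sq_le_smooth_sq) auto
    also have "\<dots> \<le> ennreal (smooth_sq q (e ^ q) (0 :: real^'n) + real (card J) * C)"
      unfolding C_def by (rule smooth_sq_sum_le[OF D q pw(1) H var s J])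
    also have "smooth_sq q (e ^ q) (0 :: real^'n) = e"
      using q pw by (simp add: smooth_sq_def power_0_left)
    finally show ?thesis by (simp add: add.commute)
  qed
  note I_le = this
  have "?I \<le> ennreal (real (card J) * C)"
  proof (rule ennreal_le_epsilon)
    fix e :: real
    assume "0 < e"
    then show "?I \<le> ennreal (real (card J) * C) + ennreal e"
      using I_le[of e] C by (simp only: ennreal_plus mult_nonneg_nonneg of_nat_0_le_iff less_imp_le)
  qed
  also have "\<dots> \<le> ennreal (real (card J) * ((exp 1)\<^sup>2 * ln (real CARD('n)) * s))"
    unfolding C_def using le s by (intro ennreal_leI mult_left_mono mult_right_mono) auto
  finally show ?thesis .
qed

subsection \<open>Independence and the iterates on the canonical sample space\<close>

lemma indep_rv_distr_pair:
  assumes M: "prob_space M" and UV: "indep_rv M S U T V"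
  shows "distr M (S \<Otimes>\<^sub>M T) (\<lambda>\<omega>. (U \<omega>, V \<omega>)) = distr M S U \<Otimes>\<^sub>M distr M T V"
proof -
  interpret prob_space M by fact
  have [measurable]: "U \<in> measurable M S" "V \<in> measurable M T"
    and ind: "indep_set {U -` A \<inter> space M | A. A \<in> sets S} {V -` B \<inter> space M | B. B \<in> sets T}"
    using UV by (auto simp: indep_rv_def)
  have U: "prob_space (distr M S U)" and V: "prob_space (distr M T V)"
    by (auto intro: prob_space_distr)
  show ?thesis
  proof (rule pair_measure_eqI[symmetric])
    fix A B assume "A \<in> sets (distr M S U)" "B \<in> sets (distr M T V)"
    then have [measurable]: "A \<in> sets S" "B \<in> sets T" by auto
    have "prob ((U -` A \<inter> space M) \<inter> (V -` B \<inter> space M)) = prob (U -` A \<inter> space M) * prob (V -` B \<inter> space M)"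
      using ind by (rule indep_setD) auto
    moreover have "(\<lambda>\<omega>. (U \<omega>, V \<omega>)) -` (A \<times> B) \<inter> space M = (U -` A \<inter> space M) \<inter> (V -` B \<inter> space M)"
      by auto
    ultimately show "emeasure (distr M S U) A * emeasure (distr M T V) B
        = emeasure (distr M (S \<Otimes>\<^sub>M T) (\<lambda>\<omega>. (U \<omega>, V \<omega>))) (A \<times> B)"
      by (simp add: emeasure_distr emeasure_eq_measure ennreal_mult)
  next
    show "sigma_finite_measure (distr M S U)" "sigma_finite_measure (distr M T V)"
      using U V by (auto intro: prob_space_imp_sigma_finite)
    show "sets (distr M S U \<Otimes>\<^sub>M distr M T V) = sets (distr M (S \<Otimes>\<^sub>M T) (\<lambda>\<omega>. (U \<omega>, V \<omega>)))"
      unfolding sets_distr by (rule sets_pair_measure_cong) simp_all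
  qed
qed

text \<open>This factorisation separates the random index from the trajectory.\<close>

lemma indep_rv_nn_integral_mult:
  assumes M: "prob_space M" and UV: "indep_rv M S U T V"
    and f[measurable]: "f \<in> borel_measurable S" and h[measurable]: "h \<in> borel_measurable T"
  shows "(\<integral>\<^sup>+\<omega>. f (U \<omega>) * h (V \<omega>) \<partial>M) = (\<integral>\<^sup>+\<omega>. f (U \<omega>) \<partial>M) * (\<integral>\<^sup>+\<omega>. h (V \<omega>) \<partial>M)"
proof -
  interpret prob_space M by fact
  have [measurable]: "U \<in> measurable M S" "V \<in> measurable M T"
    using UV by (auto simp: indep_rv_def)
  interpret V: prob_space "distr M T V" by (rule prob_space_distr) simp
  have "(\<integral>\<^sup>+\<omega>. f (U \<omega>) * h (V \<omega>) \<partial>M)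
      = (\<integral>\<^sup>+p. f (fst p) * h (snd p) \<partial>distr M (S \<Otimes>\<^sub>M T) (\<lambda>\<omega>. (U \<omega>, V \<omega>)))"
    by (subst nn_integral_distr) auto
  also have "\<dots> = (\<integral>\<^sup>+p. f (fst p) * h (snd p) \<partial>(distr M S U \<Otimes>\<^sub>M distr M T V))"
    by (simp only: indep_rv_distr_pair[OF M UV])
  also have "\<dots> = (\<integral>\<^sup>+u. \<integral>\<^sup>+v. f u * h v \<partial>distr M T V \<partial>distr M S U)"
    by (subst V.nn_integral_fst[symmetric]) auto
  also have "\<dots> = (\<integral>\<^sup>+u. f u \<partial>distr M S U) * (\<integral>\<^sup>+v. h v \<partial>distr M T V)"
    by (simp add: nn_integral_cmult nn_integral_multc)
  finally show ?thesis by (simp add: nn_integral_distr)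
qed

text \<open>Cauchy-Schwarz against the constant 1; an infinite mean has to be excluded
  separately.\<close>

lemma nn_integral_le_sqrt:
  assumes M: "prob_space M" and Z[measurable]: "Z \<in> borel_measurable M"
    and le: "(\<integral>\<^sup>+\<omega>. (Z \<omega>)\<^sup>2 \<partial>M) \<le> ennreal r" and r: "0 \<le> r"
  shows "(\<integral>\<^sup>+\<omega>. Z \<omega> \<partial>M) \<le> ennreal (sqrt r)"
proof -
  interpret prob_space M by fact
  have "(\<integral>\<^sup>+\<omega>. Z \<omega> * 1 \<partial>M)\<^sup>2 \<le> (\<integral>\<^sup>+\<omega>. (Z \<omega>)\<^sup>2 \<partial>M) * (\<integral>\<^sup>+\<omega>. 1\<^sup>2 \<partial>M)"
    by (rule Cauchy_Schwarz_nn_integral) auto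
  then have *: "(\<integral>\<^sup>+\<omega>. Z \<omega> \<partial>M)\<^sup>2 \<le> ennreal r"
    using le by (simp add: emeasure_space_1)
  show ?thesis
  proof (cases "\<integral>\<^sup>+\<omega>. Z \<omega> \<partial>M")
    case (real a)
    with * r have "a\<^sup>2 \<le> r" by (simp add: ennreal_power)
    then show ?thesis using real by (simp add: real_le_rsqrt ennreal_leI)
  next
    case top
    with * show ?thesis by (simp add: power2_eq_square ennreal_mult_top top_unique)
  qed
qed

context
  fixes X :: "(real^'n) set" and \<rho> :: real and \<eta> :: "nat \<Rightarrow> real" and m :: "nat \<Rightarrow> nat"
    and G :: "real^'n \<Rightarrow> 'b \<Rightarrow> real^'n"
begin

text \<open>The array \<open>z\<close> holds all samples, indexed by iteration and position.
  Counting starts at 0: after \<open>n\<close> steps the value corresponds to the iterate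
  \<open>x (n + 1)\<close> of the method, and the next step uses the data of iteration
  \<open>Suc n\<close>.\<close>

primrec prox_iter :: "nat \<Rightarrow> real^'n \<Rightarrow> (nat \<times> nat \<Rightarrow> 'b) \<Rightarrow> real^'n" where
  "prox_iter 0 u z = u"
| "prox_iter (Suc n) u z = prox X \<rho> (prox_iter n u z)
    (prox_iter n u z - \<eta> (Suc n) *\<^sub>R minibatch G (m (Suc n)) (prox_iter n u z) (\<lambda>i. z (Suc n, i)))"

lemma minibatch_cong:
  "(\<And>i. i \<in> {1..k} \<Longrightarrow> z i = z' i) \<Longrightarrow> minibatch G k u z = minibatch G k u z'"
  unfolding minibatch_def by (intro arg_cong[of _ _ "\<lambda>v. (1 / real k) *\<^sub>R v"] sum.cong) auto

text \<open>Adaptedness to the samples: this permits freezing the iterate while the samples of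
  iteration \<open>Suc n\<close> are integrated.\<close>

lemma prox_iter_cong:
  assumes "\<And>j i. j \<in> {1..n} \<Longrightarrow> i \<in> {1..m j} \<Longrightarrow> z (j, i) = z' (j, i)"
  shows "prox_iter n u z = prox_iter n u z'"
  using assms
proof (induction n)
  case (Suc n)
  have "prox_iter n u z = prox_iter n u z'" using Suc.prems by (intro Suc.IH) auto
  moreover have "minibatch G (m (Suc n)) (prox_iter n u z') (\<lambda>i. z (Suc n, i))
      = minibatch G (m (Suc n)) (prox_iter n u z') (\<lambda>i. z' (Suc n, i))"
    using Suc.prems by (intro minibatch_cong) auto
  ultimately show ?case by simp
qed simp

definition noise :: "(real^'n \<Rightarrow> real^'n) \<Rightarrow> nat \<Rightarrow> real^'n \<Rightarrow> (nat \<times> nat \<Rightarrow> 'b) \<Rightarrow> real^'n" where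
  "noise g n u z = minibatch G (m (Suc n)) (prox_iter n u z) (\<lambda>i. z (Suc n, i)) - g (prox_iter n u z)"

context
  fixes D :: "'b measure" and K :: nat
  assumes X: "X \<noteq> {}" "closed X" "convex X" and \<rho>: "0 \<le> \<rho>"
    and G_meas: "(\<lambda>(u, z). G u z) \<in> borel_measurable (borel \<Otimes>\<^sub>M D)"
begin

abbreviation (input) "sample_index \<equiv> (SIGMA k:{1..K}. {1..m k})"

lemma measurable_minibatch_prox_iter:
  assumes n: "n < K" and c[measurable]: "(\<lambda>(u, z). prox_iter n u z) \<in> borel_measurable (borel \<Otimes>\<^sub>M Pi\<^sub>M sample_index (\<lambda>_. D))"
  shows "(\<lambda>(u, z). minibatch G (m (Suc n)) (prox_iter n u z) (\<lambda>i. z (Suc n, i)))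
    \<in> borel_measurable (borel \<Otimes>\<^sub>M Pi\<^sub>M sample_index (\<lambda>_. D))"
proof -
  have "(\<lambda>p. G (prox_iter n (fst p) (snd p)) (snd p (Suc n, i))) \<in> borel_measurable (borel \<Otimes>\<^sub>M Pi\<^sub>M sample_index (\<lambda>_. D))"
    if "i \<in> {1..m (Suc n)}" for i
  proof -
    have "(Suc n, i) \<in> sample_index" using n that by auto
    then have "(\<lambda>p. snd p (Suc n, i)) \<in> measurable (borel \<Otimes>\<^sub>M Pi\<^sub>M sample_index (\<lambda>_. D)) D"
      by (rule measurable_compose[OF measurable_snd measurable_component_singleton])
    then have "(\<lambda>p. (prox_iter n (fst p) (snd p), snd p (Suc n, i)))
        \<in> measurable (borel \<Otimes>\<^sub>M Pi\<^sub>M sample_index (\<lambda>_. D)) (borel \<Otimes>\<^sub>M D)"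
      using c by (intro measurable_Pair) (simp_all add: split_def)
    from measurable_compose[OF this G_meas] show ?thesis by simp
  qed
  then show ?thesis
    unfolding minibatch_def split_def
    by (intro borel_measurable_scaleR borel_measurable_sum borel_measurable_const) auto
qed

text \<open>A random point is inserted into \<open>G\<close>, so joint measurability of
  \<open>G\<close> carries the induction through the minibatch, and continuity of
  \<open>prox\<close> carries it through the minimisation.\<close>

lemma measurable_prox_iter:
  assumes "n \<le> K"
  shows "(\<lambda>(u, z). prox_iter n u z) \<in> borel_measurable (borel \<Otimes>\<^sub>M Pi\<^sub>M sample_index (\<lambda>_. D))"
  using assms
proof (induction n)
  case 0
  then show ?case by (simp add: split_def)
next
  case (Suc n)
  let ?N = "borel \<Otimes>\<^sub>M Pi\<^sub>M sample_index (\<lambda>_. D)"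
  have c: "(\<lambda>(u, z). prox_iter n u z) \<in> borel_measurable ?N" using Suc by simp
  then have c'[measurable]: "(\<lambda>p. prox_iter n (fst p) (snd p)) \<in> borel_measurable ?N" by (simp add: split_def)
  have [measurable]: "(\<lambda>p. minibatch G (m (Suc n)) (prox_iter n (fst p) (snd p)) (\<lambda>i. snd p (Suc n, i))) \<in> borel_measurable ?N"
    using measurable_minibatch_prox_iter[OF _ c] Suc.prems by (simp add: split_def)
  have "(\<lambda>p. (prox_iter n (fst p) (snd p), prox_iter n (fst p) (snd p) - \<eta> (Suc n) *\<^sub>R
      minibatch G (m (Suc n)) (prox_iter n (fst p) (snd p)) (\<lambda>i. snd p (Suc n, i)))) \<in> borel_measurable ?N"
    by (intro borel_measurable_Pair) measurable
  from measurable_compose[OF this borel_measurable_continuous_onI[OF continuous_prox[OF X \<rho>]]]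
  show ?case by (simp add: split_def)
qed

lemma measurable_noise:
  assumes "n < K" and g: "g \<in> borel_measurable borel"
  shows "(\<lambda>(u, z). noise g n u z) \<in> borel_measurable (borel \<Otimes>\<^sub>M Pi\<^sub>M sample_index (\<lambda>_. D))"
proof -
  have c: "(\<lambda>(u, z). prox_iter n u z) \<in> borel_measurable (borel \<Otimes>\<^sub>M Pi\<^sub>M sample_index (\<lambda>_. D))"
    using assms by (intro measurable_prox_iter) simp
  show ?thesis
    unfolding noise_def
    using measurable_minibatch_prox_iter[OF assms(1) c] measurable_compose[OF c g]
    by (simp add: split_def borel_measurable_diff)
qed

text \<open>The samples of iteration \<open>Suc n\<close> form the block \<open>J\<close>. With the
  start and all other samples fixed, the iterate is a constant and the error is an average of
  centred independent terms; the resulting bound is uniform in what was fixed.\<close>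

lemma noise_second_moment:
  assumes D: "prob_space D" and P: "prob_space P" "sets P = sets borel" and dim: "2 \<le> CARD('n)"
    and n: "n < K" and m: "0 < m (Suc n)" and g: "g \<in> borel_measurable borel"
    and G: "\<And>u. integrable D (G u)" "\<And>u. (\<integral>z. G u z \<partial>D) = g u"
    and var: "\<And>u. (\<integral>\<^sup>+z. ennreal ((infnorm (G u z - g u))\<^sup>2) \<partial>D) \<le> ennreal s" and s: "0 \<le> s"
  shows "(\<integral>\<^sup>+p. ennreal ((infnorm (noise g n (fst p) (snd p)))\<^sup>2) \<partial>(P \<Otimes>\<^sub>M Pi\<^sub>M sample_index (\<lambda>_. D)))
    \<le> ennreal ((exp 1)\<^sup>2 * ln (real CARD('n)) * s / real (m (Suc n)))"
proof -
  interpret D: prob_space D by (rule D)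
  interpret P: prob_space P by (rule P(1))
  interpret PP: product_sigma_finite "\<lambda>_. D" by standard
  define J where "J = Pair (Suc n) ` {1..m (Suc n)}"
  define I' where "I' = sample_index - J"
  define c where "c = (exp 1)\<^sup>2 * ln (real CARD('n)) * s / real (m (Suc n))"
  have cJ: "card J = m (Suc n)" by (simp add: J_def card_image inj_on_def)
  have "J \<subseteq> sample_index" using n by (auto simp: J_def)
  then have I: "I' \<union> J = sample_index" "I' \<inter> J = {}" by (auto simp only: I'_def)
  have fin: "finite I'" "finite J" by (simp_all add: I'_def J_def)
  interpret PI: prob_space "Pi\<^sub>M sample_index (\<lambda>_. D)" by (intro prob_space_PiM D)
  interpret PI': prob_space "Pi\<^sub>M I' (\<lambda>_. D)" by (intro prob_space_PiM D)
  let ?h = "\<lambda>u z. ennreal ((infnorm (noise g n u z))\<^sup>2)"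
  have [measurable]: "(\<lambda>p. noise g n (fst p) (snd p)) \<in> borel_measurable (borel \<Otimes>\<^sub>M Pi\<^sub>M sample_index (\<lambda>_. D))"
    using measurable_noise[OF n g] by (simp add: split_def)
  have sets_eq: "sets (P \<Otimes>\<^sub>M Pi\<^sub>M sample_index (\<lambda>_. D)) = sets (borel \<Otimes>\<^sub>M Pi\<^sub>M sample_index (\<lambda>_. D))"
    using P(2) by (intro sets_pair_measure_cong) auto
  have h: "(\<lambda>p. ?h (fst p) (snd p)) \<in> borel_measurable (borel \<Otimes>\<^sub>M Pi\<^sub>M sample_index (\<lambda>_. D))"
    by measurable
  have inner: "(\<integral>\<^sup>+z. ?h u z \<partial>Pi\<^sub>M sample_index (\<lambda>_. D)) \<le> ennreal c" for u
  proof -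
    have hu: "?h u \<in> borel_measurable (Pi\<^sub>M sample_index (\<lambda>_. D))"
      using measurable_compose[OF measurable_Pair1' h, of u] by simp
    have "(\<integral>\<^sup>+z. ?h u z \<partial>Pi\<^sub>M sample_index (\<lambda>_. D))
        = (\<integral>\<^sup>+y. \<integral>\<^sup>+z. ?h u (merge I' J (y, z)) \<partial>Pi\<^sub>M J (\<lambda>_. D) \<partial>Pi\<^sub>M I' (\<lambda>_. D))"
      using PP.product_nn_integral_fold[OF I(2) fin] hu by (simp only: I(1))
    also have "\<dots> \<le> (\<integral>\<^sup>+y. ennreal c \<partial>Pi\<^sub>M I' (\<lambda>_. D))"
    proof (rule nn_integral_mono)
      fix y
      \<comment> \<open>Evaluating at \<open>y\<close> instead of the merged array is legitimate:
        the first \<open>n\<close> steps read only coordinates in \<open>I'\<close>.\<close>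
      define v where "v = prox_iter n u y"
      let ?H = "\<lambda>b. G v b - g v"
      let ?k = "m (Suc n)"
      have noise_eq: "noise g n u (merge I' J (y, z)) = (1 / real ?k) *\<^sub>R (\<Sum>j\<in>J. ?H (z j))" for z
      proof -
        have "prox_iter n u (merge I' J (y, z)) = v"
          unfolding v_def using n by (intro prox_iter_cong) (auto simp: merge_def I'_def J_def)
        moreover have "minibatch G ?k v (\<lambda>i. merge I' J (y, z) (Suc n, i)) = minibatch G ?k v (\<lambda>i. z (Suc n, i))"
          by (intro minibatch_cong) (auto simp: merge_def I'_def J_def)
        moreover have "(\<Sum>j\<in>J. ?H (z j)) = (\<Sum>i=1..?k. G v (z (Suc n, i))) - real ?k *\<^sub>R g v"
          unfolding J_def by (subst sum.reindex) (auto simp: inj_on_def sum_subtractf sum_constant_scaleR simp del: sum_constant)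
        ultimately show ?thesis
          using m by (simp add: noise_def minibatch_def scaleR_right_diff_distrib)
      qed
      have [measurable]: "?H \<in> borel_measurable D" using G(1)[of v] by auto
      have "(\<integral>\<^sup>+z. ?h u (merge I' J (y, z)) \<partial>Pi\<^sub>M J (\<lambda>_. D))
          = (\<integral>\<^sup>+z. ennreal ((1 / real ?k)\<^sup>2) * ennreal ((infnorm (\<Sum>j\<in>J. ?H (z j)))\<^sup>2) \<partial>Pi\<^sub>M J (\<lambda>_. D))"
        by (simp only: noise_eq infnorm_mul power_mult_distrib power2_abs)
          (simp only: ennreal_mult zero_le_power2)
      also have "\<dots> = ennreal ((1 / real ?k)\<^sup>2) * (\<integral>\<^sup>+z. ennreal ((infnorm (\<Sum>j\<in>J. ?H (z j)))\<^sup>2) \<partial>Pi\<^sub>M J (\<lambda>_. D))"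
        by (rule nn_integral_cmult) measurable
      also have "\<dots> \<le> ennreal ((1 / real ?k)\<^sup>2) * ennreal (real (card J) * ((exp 1)\<^sup>2 * ln (real CARD('n)) * s))"
        using G D.prob_space by (intro mult_left_mono minibatch_variance[OF D dim _ _ var s fin(2)]) auto
      also have "\<dots> = ennreal c"
        using m s by (simp add: cJ c_def ennreal_mult'[symmetric] power2_eq_square field_simps)
      finally show "(\<integral>\<^sup>+z. ?h u (merge I' J (y, z)) \<partial>Pi\<^sub>M J (\<lambda>_. D)) \<le> ennreal c" .
    qed
    finally show ?thesis by (simp add: PI'.emeasure_space_1)
  qed
  have "(\<integral>\<^sup>+p. ?h (fst p) (snd p) \<partial>(P \<Otimes>\<^sub>M Pi\<^sub>M sample_index (\<lambda>_. D))) = (\<integral>\<^sup>+u. \<integral>\<^sup>+z. ?h u z \<partial>Pi\<^sub>M sample_index (\<lambda>_. D) \<partial>P)"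
    using h unfolding measurable_cong_sets[OF sets_eq[symmetric] refl]
    by (subst PI.nn_integral_fst[symmetric]) auto
  also have "\<dots> \<le> (\<integral>\<^sup>+u. ennreal c \<partial>P)"
    using inner by (intro nn_integral_mono)
  finally show ?thesis by (simp add: P.emeasure_space_1 c_def)
qed

end

end

subsection \<open>The rate\<close>

lemma c1_eq: "c1 \<rho> = 2 * (\<rho> + 2)\<^sup>2 / (3 * \<rho> / 4 - 1 / 2)"
  by (simp add: c1_def field_simps)

text \<open>Used to absorb the coefficient \<open>c1 \<rho> / \<rho> + 2\<close> into the stated
  \<open>3 * c1 \<rho> / (2 * \<rho>) + 1\<close>.\<close>

lemma c1_ge:
  assumes "\<rho> > 3 / 2"
  shows "2 * \<rho> \<le> c1 \<rho>"
proof -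
  have "2 * \<rho> * (3 * \<rho> - 2) \<le> 8 * (\<rho> + 2)\<^sup>2"
    using assms by (simp add: power2_eq_square algebra_simps)
  then show ?thesis using assms by (simp add: c1_def le_divide_eq)
qed

text \<open>Bridges two kinds of data: the function gap has a Bochner integral, the errors are
  controlled through nonnegative integrals.\<close>

lemma nn_integral_sum_affine_le:
  fixes h :: "'w \<Rightarrow> real" and w :: "'i \<Rightarrow> 'w \<Rightarrow> real"
  assumes h: "integrable M h" "\<And>\<omega>. \<omega> \<in> space M \<Longrightarrow> 0 \<le> h \<omega>" and A: "finite A"
    and w: "\<And>k. k \<in> A \<Longrightarrow> w k \<in> borel_measurable M"
    and c: "\<And>k. k \<in> A \<Longrightarrow> 0 \<le> c k" and v: "\<And>k. k \<in> A \<Longrightarrow> 0 \<le> v k"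
    and le: "\<And>k. k \<in> A \<Longrightarrow> (\<integral>\<^sup>+\<omega>. ennreal ((w k \<omega>)\<^sup>2) \<partial>M) \<le> ennreal (v k)"
  shows "(\<integral>\<^sup>+\<omega>. ennreal (h \<omega> + (\<Sum>k\<in>A. c k * (w k \<omega>)\<^sup>2)) \<partial>M)
    \<le> ennreal ((\<integral>\<omega>. h \<omega> \<partial>M) + (\<Sum>k\<in>A. c k * v k))"
proof -
  have [measurable]: "h \<in> borel_measurable M" using h(1) by auto
  have m: "(\<lambda>\<omega>. ennreal ((w k \<omega>)\<^sup>2)) \<in> borel_measurable M" if "k \<in> A" for k
    using w[OF that] by measurable
  have "(\<integral>\<^sup>+\<omega>. ennreal (h \<omega> + (\<Sum>k\<in>A. c k * (w k \<omega>)\<^sup>2)) \<partial>M)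
      = (\<integral>\<^sup>+\<omega>. ennreal (h \<omega>) + (\<Sum>k\<in>A. ennreal (c k) * ennreal ((w k \<omega>)\<^sup>2)) \<partial>M)"
  proof (rule nn_integral_cong)
    fix \<omega> assume "\<omega> \<in> space M"
    have "(\<Sum>k\<in>A. ennreal (c k) * ennreal ((w k \<omega>)\<^sup>2)) = (\<Sum>k\<in>A. ennreal (c k * (w k \<omega>)\<^sup>2))"
      using c by (intro sum.cong refl ennreal_mult[symmetric]) auto
    also have "\<dots> = ennreal (\<Sum>k\<in>A. c k * (w k \<omega>)\<^sup>2)"
      using c by (intro sum_ennreal) auto
    finally show "ennreal (h \<omega> + (\<Sum>k\<in>A. c k * (w k \<omega>)\<^sup>2))
        = ennreal (h \<omega>) + (\<Sum>k\<in>A. ennreal (c k) * ennreal ((w k \<omega>)\<^sup>2))"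
      using h(2)[OF \<open>\<omega> \<in> space M\<close>] c by (simp only:) (rule ennreal_plus, auto intro!: sum_nonneg)
  qed
  also have "\<dots> = (\<integral>\<^sup>+\<omega>. ennreal (h \<omega>) \<partial>M) + (\<Sum>k\<in>A. \<integral>\<^sup>+\<omega>. ennreal (c k) * ennreal ((w k \<omega>)\<^sup>2) \<partial>M)"
    using m by (subst nn_integral_add) (auto intro!: nn_integral_sum borel_measurable_sum borel_measurable_times_ennreal)
  also have "\<dots> = ennreal (\<integral>\<omega>. h \<omega> \<partial>M) + (\<Sum>k\<in>A. ennreal (c k) * (\<integral>\<^sup>+\<omega>. ennreal ((w k \<omega>)\<^sup>2) \<partial>M))"
  proof -
    have "(\<integral>\<^sup>+\<omega>. ennreal (h \<omega>) \<partial>M) = ennreal (\<integral>\<omega>. h \<omega> \<partial>M)"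
      using h by (intro nn_integral_eq_integral) auto
    moreover have "(\<integral>\<^sup>+\<omega>. ennreal (c k) * ennreal ((w k \<omega>)\<^sup>2) \<partial>M) = ennreal (c k) * (\<integral>\<^sup>+\<omega>. ennreal ((w k \<omega>)\<^sup>2) \<partial>M)"
      if "k \<in> A" for k using m[OF that] by (rule nn_integral_cmult)
    ultimately show ?thesis by simp
  qed
  also have "\<dots> \<le> ennreal (\<integral>\<omega>. h \<omega> \<partial>M) + (\<Sum>k\<in>A. ennreal (c k) * ennreal (v k))"
    using le by (intro add_left_mono sum_mono mult_left_mono) auto
  also have "(\<Sum>k\<in>A. ennreal (c k) * ennreal (v k)) = ennreal (\<Sum>k\<in>A. c k * v k)"
  proof -
    have "(\<Sum>k\<in>A. ennreal (c k) * ennreal (v k)) = (\<Sum>k\<in>A. ennreal (c k * v k))"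
      using c v by (intro sum.cong refl ennreal_mult[symmetric]) auto
    then show ?thesis using c v by (simp add: sum_ennreal)
  qed
  also have "ennreal (\<integral>\<omega>. h \<omega> \<partial>M) + ennreal (\<Sum>k\<in>A. c k * v k) = ennreal ((\<integral>\<omega>. h \<omega> \<partial>M) + (\<Sum>k\<in>A. c k * v k))"
    using h c v by (intro ennreal_plus[symmetric] sum_nonneg mult_nonneg_nonneg Bochner_Integration.integral_nonneg) auto
  finally show ?thesis .
qed

lemma nn_integral_random_index:
  assumes M: "prob_space M" and ind: "indep_rv M (count_space UNIV) Y N V" and A: "finite A"
    and h: "\<And>k. k \<in> A \<Longrightarrow> h k \<in> borel_measurable N"
  shows "(\<integral>\<^sup>+\<omega>. (\<Sum>k\<in>A. indicator {k} (Y \<omega>) * h k (V \<omega>)) \<partial>M)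
    = (\<Sum>k\<in>A. emeasure M {\<omega> \<in> space M. Y \<omega> = k} * (\<integral>\<^sup>+\<omega>. h k (V \<omega>) \<partial>M))"
proof -
  have Y[measurable]: "Y \<in> measurable M (count_space UNIV)" and V: "V \<in> measurable M N"
    using ind by (auto simp: indep_rv_def)
  have prob_eq: "(\<integral>\<^sup>+\<omega>. indicator {k} (Y \<omega>) \<partial>M) = emeasure M {\<omega> \<in> space M. Y \<omega> = k}" for k
  proof -
    have "{\<omega> \<in> space M. Y \<omega> = k} \<in> sets M" by measurable
    moreover have "(\<integral>\<^sup>+\<omega>. indicator {k} (Y \<omega>) \<partial>M) = (\<integral>\<^sup>+\<omega>. indicator {\<omega> \<in> space M. Y \<omega> = k} \<omega> \<partial>M)"
      by (intro nn_integral_cong) (auto simp: indicator_def)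
    ultimately show ?thesis by simp
  qed
  have i: "(indicator {k} :: 'b \<Rightarrow> ennreal) \<in> borel_measurable (count_space UNIV)" for k :: 'b
    by simp
  have "(\<integral>\<^sup>+\<omega>. (\<Sum>k\<in>A. indicator {k} (Y \<omega>) * h k (V \<omega>)) \<partial>M)
      = (\<Sum>k\<in>A. \<integral>\<^sup>+\<omega>. indicator {k} (Y \<omega>) * h k (V \<omega>) \<partial>M)"
    using measurable_compose[OF V h] measurable_compose[OF Y i]
    by (intro nn_integral_sum borel_measurable_times_ennreal)
  also have "\<dots> = (\<Sum>k\<in>A. (\<integral>\<^sup>+\<omega>. indicator {k} (Y \<omega>) \<partial>M) * (\<integral>\<^sup>+\<omega>. h k (V \<omega>) \<partial>M))"
    using indep_rv_nn_integral_mult[OF M ind i h] by (intro sum.cong refl)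
  finally show ?thesis by (simp only: prob_eq)
qed

theorem theorem1:
  fixes X :: "(real^'n) set"
    and D :: "'b measure"
    and F :: "real^'n \<Rightarrow> 'b \<Rightarrow> real"
    and f :: "real^'n \<Rightarrow> real"
    and gradf :: "real^'n \<Rightarrow> real^'n"
    and G :: "real^'n \<Rightarrow> 'b \<Rightarrow> real^'n"
    and \<sigma> L f_low \<rho> :: real
    and K :: nat
    and m :: "nat \<Rightarrow> nat"
    and \<eta> p :: "nat \<Rightarrow> real"
    and M :: "'w measure"
    and \<zeta> :: "nat \<Rightarrow> nat \<Rightarrow> 'w \<Rightarrow> 'b"
    and x :: "nat \<Rightarrow> 'w \<Rightarrow> real^'n"
    and Y :: "'w \<Rightarrow> nat"
  defines "I \<equiv> (SIGMA k:{1..K}. {1..m k})"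
    and "\<Delta> \<equiv> (\<integral>\<omega>. f (x 1 \<omega>) \<partial>M) - f_low"
    and "S \<equiv> (\<Sum>k=1..K. \<eta> k)"
  assumes dim: "CARD('n) \<ge> 2"
    and X: "X \<noteq> {}" "closed X" "convex X"
    and D: "prob_space D"
    and F: "\<And>u. integrable D (F u)" "\<And>u. f u = (\<integral>z. F u z \<partial>D)"
    and gradf: "\<And>u. GDERIV f u :> gradf u"
    and G_meas: "(\<lambda>(u, z). G u z) \<in> borel_measurable (restrict_space borel X \<Otimes>\<^sub>M D)"
    and G_unbiased: "\<And>u. u \<in> X \<Longrightarrow> integrable D (G u)"
      "\<And>u. u \<in> X \<Longrightarrow> (\<integral>z. G u z \<partial>D) = gradf u"
    and \<sigma>: "\<sigma> \<ge> 0"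
      "ennreal (\<sigma>\<^sup>2) = (SUP u\<in>X. \<integral>\<^sup>+z. ennreal ((infnorm (G u z - gradf u))\<^sup>2) \<partial>D)"
    and L: "L > 0"
      "\<And>u v. u \<in> X \<Longrightarrow> v \<in> X \<Longrightarrow> infnorm (gradf u - gradf v) \<le> L * l1norm (u - v)"
    and f_low: "\<And>u. u \<in> X \<Longrightarrow> f_low \<le> f u"
    and K: "K > 0"
    and m: "\<And>k. k \<in> {1..K} \<Longrightarrow> m k > 0"
    and \<rho>: "\<rho> > 3 / 2"
    and \<eta>: "\<And>k. k \<in> {1..K} \<Longrightarrow> 0 < \<eta> k \<and> \<eta> k \<le> 1 / L"
    and p: "\<And>k. k \<in> {1..K} \<Longrightarrow> p k = \<eta> k / S"
    and M: "prob_space M"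
    and \<zeta>_indep: "prob_space.indep_vars M (\<lambda>_. D) (\<lambda>(k, i). \<zeta> k i) I"
    and \<zeta>_law: "\<And>k i. (k, i) \<in> I \<Longrightarrow> distr M D (\<zeta> k i) = D"
    and x1_indep: "indep_rv M
        borel (x 1) (Pi\<^sub>M I (\<lambda>_. D)) (\<lambda>\<omega>. \<lambda>(k, i)\<in>I. \<zeta> k i \<omega>)"
    and Y_indep: "indep_rv M
        (count_space UNIV) Y
        (borel \<Otimes>\<^sub>M Pi\<^sub>M I (\<lambda>_. D)) (\<lambda>\<omega>. (x 1 \<omega>, \<lambda>(k, i)\<in>I. \<zeta> k i \<omega>))"
    and Y_law: "\<And>k. k \<in> {1..K} \<Longrightarrow> measure M {\<omega> \<in> space M. Y \<omega> = k} = p k"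
    and x1: "\<And>\<omega>. \<omega> \<in> space M \<Longrightarrow> x 1 \<omega> \<in> X" "integrable M (\<lambda>\<omega>. f (x 1 \<omega>))"
    and step: "\<And>k \<omega>. k \<in> {1..K} \<Longrightarrow> \<omega> \<in> space M \<Longrightarrow>
        is_arg_min
          (\<lambda>u. 1 / 2 * (norm (u - (x k \<omega> - \<eta> k *\<^sub>R minibatch G (m k) (x k \<omega>) (\<lambda>i. \<zeta> k i \<omega>))))\<^sup>2
                + \<rho> / 2 * (l1norm (u - x k \<omega>))\<^sup>2)
          (\<lambda>u. u \<in> X) (x (k + 1) \<omega>)"
  shows "c1 \<rho> > 0 \<and>
    (\<integral>\<^sup>+\<omega>. infdist0 (frechet_subdiff (\<lambda>u. ereal (f u) + delta X u) (x (Y \<omega> + 1) \<omega>)) \<partial>M)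
      \<le> ennreal (sqrt (c1 \<rho> * \<Delta> / S)
          + sqrt ((3 * c1 \<rho> / (2 * \<rho>) + 1) * (\<Sum>k=1..K. \<eta> k / real (m k)) / S)
            * sqrt ((exp 1)\<^sup>2 * ln (real CARD('n)) * \<sigma>\<^sup>2))"
proof -
  interpret M: prob_space M by (rule M)
  interpret D: prob_space D by (rule D)
  define C where "C = (exp 1)\<^sup>2 * ln (real CARD('n)) * \<sigma>\<^sup>2"
  define \<kappa> where "\<kappa> = 3 * c1 \<rho> / (2 * \<rho>) + 1"
  have \<rho>0: "0 < \<rho>" "0 \<le> \<rho>" using \<rho> by auto
  have c1_lower: "2 * \<rho> \<le> c1 \<rho>" by (rule c1_ge[OF \<rho>])
  then have c1_pos: "0 < c1 \<rho>" using \<rho>0 by linarith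
  have C0: "0 \<le> C" using dim by (simp add: C_def)
  have \<kappa>0: "0 \<le> \<kappa>" using c1_pos \<rho>0 by (simp add: \<kappa>_def)
  have S: "0 < S" unfolding S_def using \<eta> K by (intro sum_pos) auto
  note \<eta>_pos = \<eta>[THEN conjunct1]

  obtain x0 where x0: "x0 \<in> X" using X(1) by auto
  \<comment> \<open>The oracle is measurable only on \<open>X\<close>; precomposing with \<open>R\<close> makes it total, so that the iteration
    can be run from every starting point of the canonical sample space.\<close>
  define R where "R u = (if u \<in> X then u else x0)" for u
  define G' where "G' u = G (R u)" for u
  define g' where "g' u = gradf (R u)" for u
  have R_mem: "R u \<in> X" for u using x0 by (simp add: R_def)
  have R_id: "u \<in> X \<Longrightarrow> R u = u" for u by (simp add: R_def)
  have [measurable]: "X \<in> sets borel" using X(2) by auto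
  have R_borel[measurable]: "R \<in> borel_measurable borel"
    unfolding R_def[abs_def] by measurable
  have R_meas: "R \<in> measurable borel (restrict_space borel X)"
    using R_mem by (intro measurable_restrict_space2) auto
  have G'_meas: "(\<lambda>(u, z). G' u z) \<in> borel_measurable (borel \<Otimes>\<^sub>M D)"
  proof -
    have "(\<lambda>p. (R (fst p), snd p)) \<in> measurable (borel \<Otimes>\<^sub>M D) (restrict_space borel X \<Otimes>\<^sub>M D)"
      by (intro measurable_Pair measurable_compose[OF measurable_fst R_meas] measurable_snd)
    from measurable_compose[OF this G_meas] show ?thesis by (simp add: G'_def split_def)
  qed
  have g'_meas: "g' \<in> borel_measurable borel"
  proof -
    have "(\<lambda>u. \<integral>z. G' u z \<partial>D) \<in> borel_measurable borel"
      using G'_meas by (rule D.borel_measurable_lebesgue_integral)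
    moreover have "g' = (\<lambda>u. \<integral>z. G' u z \<partial>D)"
      using G_unbiased(2) R_mem by (auto simp: g'_def G'_def)
    ultimately show ?thesis by simp
  qed
  have G'_int: "integrable D (G' u)" "(\<integral>z. G' u z \<partial>D) = g' u" for u
    using G_unbiased R_mem by (auto simp: G'_def g'_def)
  have G'_var: "(\<integral>\<^sup>+z. ennreal ((infnorm (G' u z - g' u))\<^sup>2) \<partial>D) \<le> ennreal (\<sigma>\<^sup>2)" for u
    unfolding \<sigma>(2) G'_def g'_def using R_mem by (rule SUP_upper)

  \<comment> \<open>Transfer to the canonical sample space\<close>
  define N where "N = (borel :: (real^'n) measure) \<Otimes>\<^sub>M Pi\<^sub>M I (\<lambda>_. D)"
  define Z where "Z \<omega> = (\<lambda>(k, i)\<in>I. \<zeta> k i \<omega>)" for \<omega>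
  \<comment> \<open>\<open>V\<close> carries all randomness except the index \<open>Y\<close>;
    independence makes its law a product.\<close>
  define V where "V \<omega> = (x 1 \<omega>, Z \<omega>)" for \<omega>
  define P where "P = distr M borel (x 1)"
  have x1_meas: "x 1 \<in> borel_measurable M" and Z_meas: "Z \<in> measurable M (Pi\<^sub>M I (\<lambda>_. D))"
    using x1_indep by (auto simp: indep_rv_def Z_def[abs_def])
  have V_meas: "V \<in> measurable M N"
    unfolding V_def[abs_def] N_def using x1_meas Z_meas by (rule measurable_Pair)
  have P: "prob_space P" "sets P = sets borel"
    unfolding P_def using x1_meas by (auto intro: M.prob_space_distr)
  have Z_law: "distr M (Pi\<^sub>M I (\<lambda>_. D)) Z = Pi\<^sub>M I (\<lambda>_. D)"
  proof -
    have "(1, 1) \<in> I" using K m[of 1] by (auto simp: I_def Suc_le_eq)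
    then have ne: "I \<noteq> {}" by blast
    define \<zeta>' where "\<zeta>' j = \<zeta> (fst j) (snd j)" for j
    have \<zeta>'_eq: "(\<lambda>(k, i). \<zeta> k i) = \<zeta>'" by (auto simp: \<zeta>'_def fun_eq_iff)
    have ind: "M.indep_vars (\<lambda>_. D) \<zeta>' I" using \<zeta>_indep by (simp only: \<zeta>'_eq)
    then have rv: "\<zeta>' j \<in> measurable M D" if "j \<in> I" for j
      using that unfolding M.indep_vars_def by blast
    have "distr M (Pi\<^sub>M I (\<lambda>_. D)) (\<lambda>\<omega>. \<lambda>j\<in>I. \<zeta>' j \<omega>) = Pi\<^sub>M I (\<lambda>j. distr M D (\<zeta>' j))"
      using M.indep_vars_iff_distr_eq_PiM'[of I \<zeta>' "\<lambda>_. D"] ne rv ind by blast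
    moreover have "(\<lambda>\<omega>. \<lambda>j\<in>I. \<zeta>' j \<omega>) = Z"
      by (auto simp: Z_def \<zeta>'_def fun_eq_iff restrict_def)
    moreover have "Pi\<^sub>M I (\<lambda>j. distr M D (\<zeta>' j)) = Pi\<^sub>M I (\<lambda>_. D)"
      using \<zeta>_law by (intro PiM_cong) (auto simp: \<zeta>'_def)
    ultimately show ?thesis by simp
  qed
  have V_law: "distr M N V = P \<Otimes>\<^sub>M Pi\<^sub>M I (\<lambda>_. D)"
    using indep_rv_distr_pair[OF M x1_indep] Z_law
    by (simp add: N_def V_def[abs_def] P_def Z_def[abs_def])

  let ?ch = "prox_iter X \<rho> \<eta> m G'" and ?no = "noise X \<rho> \<eta> m G' g'"
  have x_mem: "x (Suc n) \<omega> \<in> X" if "n \<le> K" "\<omega> \<in> space M" for n \<omega>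
  proof (cases n)
    case (Suc n')
    then show ?thesis using step[of n \<omega>] that by (simp add: is_arg_min_def)
  qed (use x1 that in simp)
  have x_mem': "x k \<omega> \<in> X" if "k \<in> {1..K}" "\<omega> \<in> space M" for k \<omega>
    using x_mem[of "k - 1" \<omega>] that by (cases k) auto
  have step': "is_arg_min (prox_obj \<rho> (x k \<omega>) (x k \<omega> - \<eta> k *\<^sub>R minibatch G (m k) (x k \<omega>) (\<lambda>i. \<zeta> k i \<omega>)))
      (\<lambda>u. u \<in> X) (x (Suc k) \<omega>)" if "k \<in> {1..K}" "\<omega> \<in> space M" for k \<omega>
    using step[OF that] by (simp add: prox_obj_def[abs_def])
  have mb_eq: "minibatch G' (m k) (x k \<omega>) (\<lambda>i. Z \<omega> (k, i)) = minibatch G (m k) (x k \<omega>) (\<lambda>i. \<zeta> k i \<omega>)"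
    if "k \<in> {1..K}" "\<omega> \<in> space M" for k \<omega>
  proof -
    have "x k \<omega> \<in> X" using that by (rule x_mem')
    then have "minibatch G' (m k) (x k \<omega>) (\<lambda>i. Z \<omega> (k, i)) = minibatch G (m k) (x k \<omega>) (\<lambda>i. Z \<omega> (k, i))"
      by (simp add: minibatch_def G'_def R_id)
    also have "\<dots> = minibatch G (m k) (x k \<omega>) (\<lambda>i. \<zeta> k i \<omega>)"
      using that by (intro minibatch_cong) (auto simp: Z_def I_def)
    finally show ?thesis .
  qed
  \<comment> \<open>Uniqueness of the minimiser identifies the given iterates with the canonical
    ones.\<close>
  have x_chain: "x (Suc n) \<omega> = ?ch n (x 1 \<omega>) (Z \<omega>)" if "n \<le> K" "\<omega> \<in> space M" for n \<omega>
    using that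
  proof (induction n)
    case (Suc n)
    then have IH: "?ch n (x 1 \<omega>) (Z \<omega>) = x (Suc n) \<omega>" and k: "Suc n \<in> {1..K}" by auto
    have "prox X \<rho> (x (Suc n) \<omega>) (x (Suc n) \<omega> - \<eta> (Suc n) *\<^sub>R
        minibatch G (m (Suc n)) (x (Suc n) \<omega>) (\<lambda>i. \<zeta> (Suc n) i \<omega>)) = x (Suc (Suc n)) \<omega>"
      by (rule prox_eqI[OF X \<rho>0(2) step'[OF k Suc.prems(2)]])
    then show ?case
      by (simp only: prox_iter.simps IH mb_eq[OF k Suc.prems(2)])
  qed simp

  have x_chain': "?ch (k - 1) (x 1 \<omega>) (Z \<omega>) = x k \<omega>" if "k \<in> {1..K}" "\<omega> \<in> space M" for k \<omega>
    using x_chain[of "k - 1" \<omega>] that by (cases k) auto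

  define w where "w k \<omega> = infnorm (minibatch G (m k) (x k \<omega>) (\<lambda>i. \<zeta> k i \<omega>) - gradf (x k \<omega>))" for k \<omega>
  define d where "d k \<omega> = l1norm (x (Suc k) \<omega> - x k \<omega>)" for k \<omega>
  \<comment> \<open>\<open>B k\<close> bounds the distance at \<open>x (k + 1)\<close>;
    \<open>wV\<close> and \<open>BV\<close> are \<open>w\<close> and \<open>B\<close> as functions
    on the canonical space.\<close>
  define B where "B k \<omega> = (\<rho> + 2) * d k \<omega> / \<eta> k + w k \<omega>" for k \<omega>
  define wV where "wV k p = infnorm (?no (k - 1) (fst p) (snd p))" for k p
  define BV where "BV k p = (\<rho> + 2) * l1norm (?ch k (fst p) (snd p) - ?ch (k - 1) (fst p) (snd p)) / \<eta> k + wV k p" for k p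
  have w_V: "w k \<omega> = wV k (V \<omega>)" if "k \<in> {1..K}" "\<omega> \<in> space M" for k \<omega>
  proof -
    have "?ch (k - 1) (x 1 \<omega>) (Z \<omega>) = x k \<omega>" using that by (rule x_chain')
    moreover have "g' (x k \<omega>) = gradf (x k \<omega>)" using x_mem'[OF that] by (simp add: g'_def R_id)
    ultimately show ?thesis
      using mb_eq[OF that] that by (simp add: w_def wV_def V_def noise_def)
  qed
  have B_V: "B k \<omega> = BV k (V \<omega>)" if "k \<in> {1..K}" "\<omega> \<in> space M" for k \<omega>
    using w_V[OF that] x_chain'[OF that] x_chain[of k \<omega>] that
    by (simp add: B_def BV_def d_def V_def)
  have ch_meas: "(\<lambda>p. ?ch n (fst p) (snd p)) \<in> borel_measurable N" if "n \<le> K" for n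
    using measurable_prox_iter[OF X \<rho>0(2) G'_meas that, where m = m and \<eta> = \<eta>] by (simp add: N_def I_def split_def)
  have wV_meas: "wV k \<in> borel_measurable N" if "k \<in> {1..K}" for k
  proof -
    have "(\<lambda>p. ?no (k - 1) (fst p) (snd p)) \<in> borel_measurable N"
      using measurable_noise[OF X \<rho>0(2) G'_meas _ g'_meas, where n = "k - 1" and K = K and m = m and \<eta> = \<eta>] that
      by (auto simp add: N_def I_def split_def)
    from measurable_compose[OF this infnorm_measurable] show ?thesis by (simp add: wV_def[abs_def])
  qed
  have BV_meas: "BV k \<in> borel_measurable N" if "k \<in> {1..K}" for k
  proof -
    have "(\<lambda>p. l1norm (?ch k (fst p) (snd p) - ?ch (k - 1) (fst p) (snd p))) \<in> borel_measurable N"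
      using that by (intro measurable_compose[OF borel_measurable_diff[OF ch_meas ch_meas] l1norm_measurable]) auto
    with wV_meas[OF that] show ?thesis unfolding BV_def[abs_def] by measurable
  qed
  have w_meas: "w k \<in> borel_measurable M" if "k \<in> {1..K}" for k
    using measurable_compose[OF V_meas wV_meas[OF that]] w_V[OF that] measurable_cong[of M "w k" "\<lambda>\<omega>. wV k (V \<omega>)"] by blast
  have w_var: "(\<integral>\<^sup>+\<omega>. ennreal ((w k \<omega>)\<^sup>2) \<partial>M) \<le> ennreal (C / real (m k))" if k: "k \<in> {1..K}" for k
  proof -
    have wV2: "(\<lambda>p. ennreal ((wV k p)\<^sup>2)) \<in> borel_measurable N"
      using wV_meas[OF k] by measurable
    have "(\<integral>\<^sup>+\<omega>. ennreal ((w k \<omega>)\<^sup>2) \<partial>M) = (\<integral>\<^sup>+\<omega>. ennreal ((wV k (V \<omega>))\<^sup>2) \<partial>M)"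
      using w_V[OF k] by (intro nn_integral_cong) simp
    also have "\<dots> = (\<integral>\<^sup>+p. ennreal ((wV k p)\<^sup>2) \<partial>(P \<Otimes>\<^sub>M Pi\<^sub>M I (\<lambda>_. D)))"
      unfolding V_law[symmetric] using V_meas wV2 by (intro nn_integral_distr[symmetric]) simp_all
    also have "\<dots> \<le> ennreal (C / real (m k))"
    proof -
      have "k - 1 < K" "Suc (k - 1) = k" using k by auto
      then show ?thesis
        using noise_second_moment[OF X \<rho>0(2) G'_meas D P dim _ _ g'_meas G'_int G'_var zero_le_power2, where n = "k - 1" and K = K and m = m and \<eta> = \<eta>] m[OF k]
        by (simp add: wV_def C_def I_def)
    qed
    finally show ?thesis .
  qed

  \<comment> \<open>Pathwise estimates\<close>
  have descent: "(3 * \<rho> / 4 - 1 / 2) * (\<Sum>k=1..K. (d k \<omega>)\<^sup>2 / \<eta> k)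
      \<le> f (x 1 \<omega>) - f_low + (\<Sum>k=1..K. \<eta> k / \<rho> * (w k \<omega>)\<^sup>2)" if \<omega>: "\<omega> \<in> space M" for \<omega>
  proof -
    have one: "(3 * \<rho> / 4 - 1 / 2) * ((d k \<omega>)\<^sup>2 / \<eta> k)
        \<le> - (f (x (Suc k) \<omega>) - f (x k \<omega>)) + \<eta> k / \<rho> * (w k \<omega>)\<^sup>2" if k: "k \<in> {1..K}" for k
    proof -
      have "x k \<omega> \<in> X" using k \<omega> by (rule x_mem')
      from prox_step_descent[OF X(3) \<rho>0(1) _ _ L(1) gradf L(2) this step'[OF k \<omega>]] \<eta>[OF k]
      show ?thesis by (simp add: d_def w_def)
    qed
    have "(3 * \<rho> / 4 - 1 / 2) * (\<Sum>k=1..K. (d k \<omega>)\<^sup>2 / \<eta> k)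
        \<le> (\<Sum>k=1..K. - (f (x (Suc k) \<omega>) - f (x k \<omega>)) + \<eta> k / \<rho> * (w k \<omega>)\<^sup>2)"
      unfolding sum_distrib_left by (intro sum_mono one)
    also have "\<dots> = - (\<Sum>k=1..K. f (x (Suc k) \<omega>) - f (x k \<omega>)) + (\<Sum>k=1..K. \<eta> k / \<rho> * (w k \<omega>)\<^sup>2)"
      by (simp only: sum.distrib sum_negf)
    also have "(\<Sum>k=1..K. f (x (Suc k) \<omega>) - f (x k \<omega>)) = f (x (Suc K) \<omega>) - f (x 1 \<omega>)"
      using K by (intro sum_Suc_diff) simp
    also have "- (f (x (Suc K) \<omega>) - f (x 1 \<omega>)) \<le> f (x 1 \<omega>) - f_low"
      using f_low[OF x_mem[of K \<omega>]] \<omega> by simp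
    finally show ?thesis by simp
  qed

  have B_sq: "(\<Sum>k=1..K. p k * (B k \<omega>)\<^sup>2)
      \<le> c1 \<rho> / S * (f (x 1 \<omega>) - f_low) + (\<Sum>k=1..K. \<kappa> / S * \<eta> k * (w k \<omega>)\<^sup>2)" if \<omega>: "\<omega> \<in> space M" for \<omega>
  proof -
    define a where "a = 3 * \<rho> / 4 - 1 / 2"
    have a: "0 < a" using \<rho> by (simp add: a_def)
    have c1a: "2 * (\<rho> + 2)\<^sup>2 = c1 \<rho> * a" using a by (simp add: c1_eq a_def)
    \<comment> \<open>The weight \<open>\<eta> k\<close> turns the squared step term into
      \<open>(d k \<omega>)\<^sup>2 / \<eta> k\<close>, exactly what \<open>descent\<close> sums.
      The factor 2 from squaring a sum enters \<open>c1\<close>.\<close>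
    have one: "\<eta> k * (B k \<omega>)\<^sup>2 \<le> c1 \<rho> * a * ((d k \<omega>)\<^sup>2 / \<eta> k) + 2 * \<eta> k * (w k \<omega>)\<^sup>2" if k: "k \<in> {1..K}" for k
    proof -
      have "(s + t)\<^sup>2 \<le> 2 * s\<^sup>2 + 2 * t\<^sup>2" for s t :: real
        using sum_squares_bound[of s t] by (simp add: power2_sum)
      then have "\<eta> k * (B k \<omega>)\<^sup>2 \<le> \<eta> k * (2 * ((\<rho> + 2) * d k \<omega> / \<eta> k)\<^sup>2 + 2 * (w k \<omega>)\<^sup>2)"
        unfolding B_def using \<eta>_pos[OF k] by (intro mult_left_mono) auto
      also have "\<dots> = 2 * (\<rho> + 2)\<^sup>2 * ((d k \<omega>)\<^sup>2 / \<eta> k) + 2 * \<eta> k * (w k \<omega>)\<^sup>2"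
      proof -
        have "\<eta> k * (2 * (s * t / (\<eta> k)\<^sup>2) + 2 * u) = 2 * s * (t / \<eta> k) + 2 * \<eta> k * u" for s t u
          using \<eta>_pos[OF k] by (simp add: field_simps power2_eq_square)
        then show ?thesis by (simp only: power_divide power_mult_distrib)
      qed
      finally show ?thesis by (simp only: c1a)
    qed
    have "S * (\<Sum>k=1..K. p k * (B k \<omega>)\<^sup>2) = (\<Sum>k=1..K. \<eta> k * (B k \<omega>)\<^sup>2)"
      unfolding sum_distrib_left using S p by (intro sum.cong) auto
    also have "\<dots> \<le> (\<Sum>k=1..K. c1 \<rho> * a * ((d k \<omega>)\<^sup>2 / \<eta> k) + 2 * \<eta> k * (w k \<omega>)\<^sup>2)"
      by (intro sum_mono one)
    also have "\<dots> = c1 \<rho> * (a * (\<Sum>k=1..K. (d k \<omega>)\<^sup>2 / \<eta> k)) + (\<Sum>k=1..K. 2 * \<eta> k * (w k \<omega>)\<^sup>2)"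
      by (simp only: sum.distrib sum_distrib_left mult.assoc)
    also have "\<dots> \<le> c1 \<rho> * (f (x 1 \<omega>) - f_low + (\<Sum>k=1..K. \<eta> k / \<rho> * (w k \<omega>)\<^sup>2)) + (\<Sum>k=1..K. 2 * \<eta> k * (w k \<omega>)\<^sup>2)"
      using descent[OF \<omega>] c1_pos unfolding a_def by (intro add_right_mono mult_left_mono) auto
    also have "\<dots> = c1 \<rho> * (f (x 1 \<omega>) - f_low) + (\<Sum>k=1..K. (c1 \<rho> / \<rho> + 2) * (\<eta> k * (w k \<omega>)\<^sup>2))"
      by (simp add: distrib_left sum_distrib_left sum.distrib[symmetric] distrib_right mult_ac)
    also have "\<dots> \<le> c1 \<rho> * (f (x 1 \<omega>) - f_low) + (\<Sum>k=1..K. \<kappa> * (\<eta> k * (w k \<omega>)\<^sup>2))"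
    proof -
      \<comment> \<open>Equivalent to \<open>2 * \<rho> \<le> c1 \<rho>\<close>.\<close>
      have "c1 \<rho> / \<rho> + 2 \<le> \<kappa>" using c1_lower \<rho>0 by (simp add: \<kappa>_def field_simps)
      then show ?thesis using \<eta>_pos by (intro add_left_mono sum_mono mult_right_mono) (auto simp: less_imp_le)
    qed
    also have "\<dots> = S * (c1 \<rho> / S * (f (x 1 \<omega>) - f_low) + (\<Sum>k=1..K. \<kappa> / S * \<eta> k * (w k \<omega>)\<^sup>2))"
      using S by (simp add: distrib_left sum_distrib_left mult.assoc)
    finally show ?thesis using S by simp
  qed

  \<comment> \<open>Averaging over the samples and the random index\<close>
  define r where "r = c1 \<rho> / S * \<Delta> + (\<Sum>k=1..K. \<kappa> / S * \<eta> k * (C / real (m k)))"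
  have \<Delta>_eq: "(\<integral>\<omega>. c1 \<rho> / S * (f (x 1 \<omega>) - f_low) \<partial>M) = c1 \<rho> / S * \<Delta>"
    using x1(2) by (simp add: \<Delta>_def M.prob_space)
  have gap0: "0 \<le> c1 \<rho> / S * (f (x 1 \<omega>) - f_low)" if "\<omega> \<in> space M" for \<omega>
    using f_low[OF x1(1)[OF that]] c1_pos S by simp
  have \<Delta>0: "0 \<le> c1 \<rho> / S * \<Delta>"
    unfolding \<Delta>_eq[symmetric] using gap0 by (intro Bochner_Integration.integral_nonneg)
  have sum0: "0 \<le> (\<Sum>k=1..K. \<kappa> / S * \<eta> k * (C / real (m k)))"
    using \<kappa>0 S C0 \<eta>_pos by (intro sum_nonneg mult_nonneg_nonneg divide_nonneg_nonneg) (auto simp: less_imp_le)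
  have r0: "0 \<le> r" using \<Delta>0 sum0 by (simp add: r_def)
  have moment: "(\<integral>\<^sup>+\<omega>. ennreal (\<Sum>k=1..K. p k * (B k \<omega>)\<^sup>2) \<partial>M) \<le> ennreal r"
  proof -
    have "(\<integral>\<^sup>+\<omega>. ennreal (\<Sum>k=1..K. p k * (B k \<omega>)\<^sup>2) \<partial>M)
        \<le> (\<integral>\<^sup>+\<omega>. ennreal (c1 \<rho> / S * (f (x 1 \<omega>) - f_low) + (\<Sum>k=1..K. \<kappa> / S * \<eta> k * (w k \<omega>)\<^sup>2)) \<partial>M)"
      by (intro nn_integral_mono ennreal_leI B_sq)
    also have "\<dots> \<le> ennreal ((\<integral>\<omega>. c1 \<rho> / S * (f (x 1 \<omega>) - f_low) \<partial>M) + (\<Sum>k=1..K. \<kappa> / S * \<eta> k * (C / real (m k))))"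
      using x1(2) gap0 w_meas w_var \<kappa>0 S C0 \<eta>_pos
      by (intro nn_integral_sum_affine_le) (auto simp: less_imp_le)
    finally show ?thesis by (simp only: r_def \<Delta>_eq)
  qed

  \<comment> \<open>The measurable majorant of the distance: the indicators select
    \<open>B (Y \<omega>) \<omega>\<close>, and each summand is a product of independent factors.
    Squaring commutes with the selection.\<close>
  define Q where "Q \<omega> = (\<Sum>k\<in>{1..K}. indicator {k} (Y \<omega>) * ennreal (BV k (V \<omega>)))" for \<omega>
  have Y_meas: "Y \<in> measurable M (count_space UNIV)" and Y_indep': "indep_rv M (count_space UNIV) Y N V"
    using Y_indep by (auto simp: indep_rv_def N_def V_def[abs_def] Z_def)
  have pk: "emeasure M {\<omega> \<in> space M. Y \<omega> = k} = ennreal (p k)" "0 \<le> p k" if "k \<in> {1..K}" for k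
    using Y_law[OF that] by (auto simp: M.emeasure_eq_measure simp flip: Y_law[OF that])
  have Q_pick: "Q \<omega> = ennreal (B (Y \<omega>) \<omega>)" "(Q \<omega>)\<^sup>2 = (\<Sum>k\<in>{1..K}. indicator {k} (Y \<omega>) * ennreal ((BV k (V \<omega>))\<^sup>2))"
    if "\<omega> \<in> space M" "Y \<omega> \<in> {1..K}" for \<omega>
  proof -
    have sel: "(\<Sum>k\<in>{1..K}. indicator {k} (Y \<omega>) * h k) = h (Y \<omega>)" for h :: "nat \<Rightarrow> ennreal"
    proof -
      have "(\<Sum>k\<in>{1..K}. indicator {k} (Y \<omega>) * h k) = (\<Sum>k\<in>{1..K}. if k = Y \<omega> then h k else 0)"
        by (intro sum.cong) auto
      then show ?thesis using that(2) by simp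
    qed
    have "0 \<le> BV (Y \<omega>) (V \<omega>)"
      unfolding B_V[OF that(2,1), symmetric] B_def w_def d_def using \<rho>0 \<eta>_pos[OF that(2)] by simp
    then show "Q \<omega> = ennreal (B (Y \<omega>) \<omega>)" "(Q \<omega>)\<^sup>2 = (\<Sum>k\<in>{1..K}. indicator {k} (Y \<omega>) * ennreal ((BV k (V \<omega>))\<^sup>2))"
      unfolding Q_def sel using B_V[OF that(2,1)] by (simp_all add: ennreal_power)
  qed
  \<comment> \<open>The weights \<open>p k\<close> sum to 1, so values of \<open>Y\<close> outside
    \<open>{1..K}\<close>, where nothing bounds the distance, form a null event.\<close>
  have Y_range: "AE \<omega> in M. Y \<omega> \<in> {1..K}"
  proof -
    have "M.prob {\<omega> \<in> space M. Y \<omega> \<in> {1..K}} = (\<Sum>k\<in>{1..K}. M.prob {\<omega> \<in> space M. Y \<omega> = k})"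
    proof -
      have "{\<omega> \<in> space M. Y \<omega> \<in> {1..K}} = (\<Union>k\<in>{1..K}. {\<omega> \<in> space M. Y \<omega> = k})" by auto
      moreover have "{\<omega> \<in> space M. Y \<omega> = k} \<in> sets M" for k using Y_meas by measurable
      ultimately show ?thesis
        by (simp only:) (intro M.finite_measure_finite_Union, auto simp: disjoint_family_on_def)
    qed
    also have "\<dots> = (\<Sum>k\<in>{1..K}. \<eta> k / S)" using Y_law p by (intro sum.cong) auto
    also have "\<dots> = 1" using S by (simp add: sum_divide_distrib[symmetric] S_def)
    finally show ?thesis
      using Y_meas by (subst M.prob_Collect_eq_1[symmetric]) auto
  qed
  have Q_meas: "Q \<in> borel_measurable M"
    unfolding Q_def[abs_def]
  proof (intro borel_measurable_sum borel_measurable_times_ennreal)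
    fix k assume k: "k \<in> {1..K}"
    show "(\<lambda>\<omega>. indicator {k} (Y \<omega>) :: ennreal) \<in> borel_measurable M"
      by (rule measurable_compose[OF Y_meas]) simp
    show "(\<lambda>\<omega>. ennreal (BV k (V \<omega>))) \<in> borel_measurable M"
      using measurable_compose[OF V_meas BV_meas[OF k]] by measurable
  qed
  have BV2: "(\<lambda>p. ennreal ((BV k p)\<^sup>2)) \<in> borel_measurable N" if "k \<in> {1..K}" for k
    using BV_meas[OF that] by measurable
  have "(\<integral>\<^sup>+\<omega>. (Q \<omega>)\<^sup>2 \<partial>M)
      = (\<integral>\<^sup>+\<omega>. (\<Sum>k\<in>{1..K}. indicator {k} (Y \<omega>) * ennreal ((BV k (V \<omega>))\<^sup>2)) \<partial>M)"
    using Y_range Q_pick(2) by (intro nn_integral_cong_AE) auto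
  also have "\<dots> = (\<Sum>k\<in>{1..K}. ennreal (p k) * (\<integral>\<^sup>+\<omega>. ennreal ((BV k (V \<omega>))\<^sup>2) \<partial>M))"
    using nn_integral_random_index[OF M Y_indep' _ BV2, of "{1..K}"] pk(1) by simp
  also have "\<dots> = (\<integral>\<^sup>+\<omega>. (\<Sum>k\<in>{1..K}. ennreal (p k) * ennreal ((BV k (V \<omega>))\<^sup>2)) \<partial>M)"
    using measurable_compose[OF V_meas BV2]
    by (subst nn_integral_sum) (auto simp: nn_integral_cmult)
  also have "\<dots> = (\<integral>\<^sup>+\<omega>. ennreal (\<Sum>k=1..K. p k * (B k \<omega>)\<^sup>2) \<partial>M)"
  proof (rule nn_integral_cong)
    fix \<omega> assume \<omega>: "\<omega> \<in> space M"
    have "(\<Sum>k\<in>{1..K}. ennreal (p k) * ennreal ((BV k (V \<omega>))\<^sup>2)) = (\<Sum>k\<in>{1..K}. ennreal (p k * (B k \<omega>)\<^sup>2))"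
      using pk(2) B_V[OF _ \<omega>] by (intro sum.cong) (auto simp: ennreal_mult)
    also have "\<dots> = ennreal (\<Sum>k=1..K. p k * (B k \<omega>)\<^sup>2)"
      using pk(2) by (intro sum_ennreal) auto
    finally show "(\<Sum>k\<in>{1..K}. ennreal (p k) * ennreal ((BV k (V \<omega>))\<^sup>2)) = ennreal (\<Sum>k=1..K. p k * (B k \<omega>)\<^sup>2)" .
  qed
  also note moment
  finally have Q_sq: "(\<integral>\<^sup>+\<omega>. (Q \<omega>)\<^sup>2 \<partial>M) \<le> ennreal r" .

  have "(\<integral>\<^sup>+\<omega>. infdist0 (frechet_subdiff (\<lambda>u. ereal (f u) + delta X u) (x (Y \<omega> + 1) \<omega>)) \<partial>M) \<le> (\<integral>\<^sup>+\<omega>. Q \<omega> \<partial>M)"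
  proof (rule nn_integral_mono_AE)
    show "AE \<omega> in M. infdist0 (frechet_subdiff (\<lambda>u. ereal (f u) + delta X u) (x (Y \<omega> + 1) \<omega>)) \<le> Q \<omega>"
      using Y_range AE_space
    proof eventually_elim
      case (elim \<omega>)
      have mem: "x (Y \<omega>) \<omega> \<in> X" using elim by (rule x_mem')
      from infdist0_prox_step_le[OF X(3) \<rho>0(2) _ _ L(1) gradf L(2) mem step'[OF elim]] \<eta>[OF elim(1)]
      show ?case unfolding Q_pick(1)[OF elim(2,1)] by (simp add: B_def d_def w_def)
    qed
  qed
  also have "\<dots> \<le> ennreal (sqrt r)" by (rule nn_integral_le_sqrt[OF M Q_meas Q_sq r0])
  also have "\<dots> \<le> ennreal (sqrt (c1 \<rho> * \<Delta> / S) + sqrt (\<kappa> * (\<Sum>k=1..K. \<eta> k / real (m k)) / S) * sqrt C)"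
  proof (rule ennreal_leI)
    have "sqrt r \<le> sqrt (c1 \<rho> / S * \<Delta>) + sqrt (\<Sum>k=1..K. \<kappa> / S * \<eta> k * (C / real (m k)))"
      unfolding r_def using \<Delta>0 sum0 by (rule sqrt_add_le_add_sqrt)
    also have "(\<Sum>k=1..K. \<kappa> / S * \<eta> k * (C / real (m k))) = \<kappa> * (\<Sum>k=1..K. \<eta> k / real (m k)) / S * C"
      by (simp add: sum_distrib_left sum_distrib_right sum_divide_distrib mult_ac)
    finally show "sqrt r \<le> sqrt (c1 \<rho> * \<Delta> / S) + sqrt (\<kappa> * (\<Sum>k=1..K. \<eta> k / real (m k)) / S) * sqrt C"
      by (simp only: times_divide_eq_left real_sqrt_mult[of "\<kappa> * (\<Sum>k=1..K. \<eta> k / real (m k)) / S" C, unfolded times_divide_eq_left])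
  qed
  finally show ?thesis using c1_pos by (simp only: \<kappa>_def C_def)
qed

end
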